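(* Let $d\ge 2$ be an integer and $p\in[0,1]$ with $pd<1$ (both fixed). For each integer $k\ge2$ let $q_c(k)$ denote the critical value $q_c(p)$ of the model with long edges of length $k$. Then, as $k\to\infty$, $$q_c(k) = (1-pd)\cdot\frac{1}{d^k} + \frac{(1-pd)^2p^2d}{1-p^2d}\cdot\frac{1}{d^{2k}} + o\left(\frac{1}{d^{2k}}\right).$$
   Context: Let $[d]=\{1,\dots,d\}$ and $V=\bigcup_{n\ge 0}[d]^n$, where $[d]^0=\{o\}$ ($o$ is the root, the empty sequence); $u\cdot v$ denotes concatenation of sequences, with $o\cdot v=v\cdot o=v$. For $k\ge2$ let $\mathbb{T}=\mathbb{T}_{d,k}=(V,E)$ be the oriented graph with $E=E_s\cup E_\ell$, where $E_s=\{\langle r,r\cdot i\rangle: r\in V,\ i\in[d]\}$ (short edges) and $E_\ell=\{\langle r,r\cdot i\rangle: r\in V,\ i\in[d]^k\}$ (long edges). Under $\mathbb{P}_{p,q}$, all edges are independent, each short edge is open with probability $p$ and each long edge is open with probability $q$. The cluster of the root $\mathscr{C}_{p,q}$ is the set of vertices that can be reached from $o$ by an oriented open path (including $o$). The critical value is $q_c=\inf\{q\in[0,1]:\ \mathbb{P}(|\mathscr{C}_{p,q}|=\infty)>0\}$, depending on $p,d,k$. *)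

theory Defs
  imports "HOL-Probability.Probability" "HOL-Library.Landau_Symbols"
begin

text \<open>
  Vertices are finite sequences, represented as lists; the root is the empty list and
  concatenation is list append.
\<close>

definition words :: "nat \<Rightarrow> nat \<Rightarrow> nat list set" where
  "words d n = {w. length w = n \<and> set w \<subseteq> {1..d}}"

definition vertices :: "nat \<Rightarrow> nat list set" where
  "vertices d = (\<Union>n. words d n)"

type_synonym edge = "nat list \<times> nat list"

definition short_edges :: "nat \<Rightarrow> edge set" where
  "short_edges d = {(r, r @ [i]) | r i. r \<in> vertices d \<and> i \<in> {1..d}}"

definition long_edges :: "nat \<Rightarrow> nat \<Rightarrow> edge set" where
  "long_edges d k = {(r, r @ w) | r w. r \<in> vertices d \<and> w \<in> words d k}"

definition edges :: "nat \<Rightarrow> nat \<Rightarrow> edge set" where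
  "edges d k = short_edges d \<union> long_edges d k"

text \<open>
  A configuration maps each edge to \<^term>\<open>True\<close> (open) or \<^term>\<open>False\<close> (closed).
  The model is meant for \<open>k \<ge> 2\<close>, where short and long edges are disjoint.
\<close>

definition percolation :: "nat \<Rightarrow> nat \<Rightarrow> real \<Rightarrow> real \<Rightarrow> (edge \<Rightarrow> bool) measure" where
  "percolation d k p q =
     (\<Pi>\<^sub>M e\<in>edges d k. measure_pmf (bernoulli_pmf (if e \<in> short_edges d then p else q)))"

definition root_cluster :: "nat \<Rightarrow> nat \<Rightarrow> (edge \<Rightarrow> bool) \<Rightarrow> nat list set" where
  "root_cluster d k \<omega> = {v. ([], v) \<in> {e \<in> edges d k. \<omega> e}\<^sup>*}"

definition critical_value :: "nat \<Rightarrow> nat \<Rightarrow> real \<Rightarrow> real" where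
  "critical_value d k p =
     Inf {q \<in> {0..1}. measure (percolation d k p q)
            {\<omega> \<in> space (percolation d k p q). infinite (root_cluster d k \<omega>)} > 0}"

text \<open>
  The event in the definition of the critical value is measurable, so \<^const>\<open>measure\<close>
  does not return its default value \<open>0\<close> there.
\<close>

lemma sets_infinite_root_cluster:
  "{\<omega> \<in> space (percolation d k p q). infinite (root_cluster d k \<omega>)}
     \<in> sets (percolation d k p q)"
proof -
  let ?M = "percolation d k p q"
  have edge: "Measurable.pred ?M (\<lambda>\<omega>. e \<in> {e \<in> edges d k. \<omega> e})" for e
  proof (cases "e \<in> edges d k")
    case True
    have "(\<lambda>\<omega>. \<omega> e) \<in> ?M \<rightarrow>\<^sub>M
        measure_pmf (bernoulli_pmf (if e \<in> short_edges d then p else q))"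
      unfolding percolation_def by (rule measurable_component_singleton[OF True])
    then show ?thesis using True by simp
  qed simp
  have step: "Measurable.pred ?M (\<lambda>\<omega>. ([], v) \<in> {e \<in> edges d k. \<omega> e} ^^ n)" for v n
  proof (induction n arbitrary: v)
    case (Suc n)
    have "Measurable.pred ?M (\<lambda>\<omega>. \<exists>u. ([], u) \<in> {e \<in> edges d k. \<omega> e} ^^ n
            \<and> (u, v) \<in> {e \<in> edges d k. \<omega> e})"
      by (intro pred_intros_countable pred_intros_logic Suc.IH edge)
    then show ?case by (simp add: relcomp_unfold)
  qed simp
  have mem: "Measurable.pred ?M (\<lambda>\<omega>. v \<in> root_cluster d k \<omega>)" for v
    unfolding root_cluster_def mem_Collect_eq rtrancl_power
    by (intro pred_intros_countable step)
  have inf_iff: "infinite A \<longleftrightarrow> (\<forall>n. \<exists>v. n \<le> to_nat v \<and> v \<in> A)" for A :: "nat list set"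
  proof -
    have "infinite A \<longleftrightarrow> infinite (to_nat ` A)"
      by (simp add: finite_image_iff inj_on_def)
    then show ?thesis unfolding infinite_nat_iff_unbounded_le by blast
  qed
  have "Measurable.pred ?M (\<lambda>\<omega>. infinite (root_cluster d k \<omega>))"
    unfolding inf_iff
    by (intro pred_intros_countable pred_intros_logic mem) simp
  then show ?thesis by (simp add: pred_def)
qed

end

theory Submission
  imports Defs
begin

text \<open>
  Every vertex has at most two incoming edges, one short and one long. Fix a word \<open>v\<close> and let
  \<open>X i\<close> be the event that its prefix of length \<open>i\<close> lies in the cluster. Then
    \<open>P(X n) = p P(X (n - 1)) + q P(X (n - k)) - p q P(X (n - 1) \<inter> X (n - k))\<close>,
  and summation over all words gives a recursion for the mean number \<open>z n\<close> of cluster vertices at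
  level \<open>n\<close>. Without the last term the sequence \<open>z\<close> would be critical exactly for
  \<open>p d + q d^k = 1\<close>; this is the leading term of the expansion.

  The second term measures the loss caused by vertices that are entered twice. Two open paths that
  end in the levels \<open>n - k\<close> and \<open>n - 1\<close> of the same ray split at some last common level
  \<open>n - k - j\<close>. The dominant way to do so, for \<open>j \<ge> 1\<close>, is that one path continues with \<open>j\<close> short
  edges while the other one takes a long edge and then \<open>j - 1\<close> short edges. This has probability
  \<open>q p^(2 j - 1)\<close>. Together with the factor \<open>p q\<close> and with the \<open>d^(k + j)\<close> words below a vertex, the
  sum over \<open>j\<close> is \<open>q^2 d^k S\<close> where \<open>S = p^2 d / (1 - p^2 d)\<close>. The critical equation
  \<open>p d + q d^k - q^2 d^k S = 1\<close> has the solution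
  \<open>q = (1 - p d) / d^k + (1 - p d)^2 S / d^(2 k)\<close> up to smaller terms.

  Only two soft facts connect \<open>z\<close> with the critical value. If the partial sums of \<open>z\<close> are bounded,
  the cluster is almost surely finite, by Borel and Cantelli
  (\<open>prob_infinite_root_cluster_eq_0\<close>). If \<open>z n > 1\<close> for some \<open>n \<ge> 1\<close>, the levels
  \<open>n, 2 n, 3 n, ...\<close> carry an embedded supercritical branching process, because paths inside
  disjoint subtrees are independent (\<open>prob_infinite_root_cluster_pos\<close>). So no growth rate has to be
  computed:

  \<^item> For \<open>q\<close> slightly below the claimed value, the loops with \<open>j \<le> J\<close> for a large constant \<open>J\<close>
    already remove enough mass to bound the partial sums (\<open>joint_ge_short_loops\<close>,
    \<open>partial_sums_bounded_if_subcritical\<close>).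

  \<^item> For \<open>q\<close> slightly above it, a union bound along pairs of paths shows that all loops together
    remove hardly more than \<open>q^2 d^k S\<close> (\<open>joint_le_pair_weight\<close>, \<open>sum_pair_weight_le\<close>), which is
    incompatible with \<open>z n \<le> 1\<close> for all \<open>n\<close> (\<open>exceeds_one_if_supercritical\<close>).
\<close>

section \<open>Independence of events that depend on disjoint sets of coordinates\<close>

text \<open>
  For a measurable event this replaces membership in the sigma-algebra generated by the
  coordinates in \<open>K\<close>; in this pointwise form it can be checked without measure theory.
\<close>

definition depends_on :: "'i set \<Rightarrow> (('i \<Rightarrow> 'a) \<Rightarrow> bool) \<Rightarrow> bool" where
  "depends_on K Y \<longleftrightarrow> (\<forall>\<omega> \<omega>'. (\<forall>i\<in>K. \<omega> i = \<omega>' i) \<longrightarrow> Y \<omega> = Y \<omega>')"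

lemma depends_onI:
  assumes "\<And>\<omega> \<omega>'. \<lbrakk>\<And>i. i \<in> K \<Longrightarrow> \<omega> i = \<omega>' i; Y \<omega>\<rbrakk> \<Longrightarrow> Y \<omega>'"
  shows "depends_on K Y"
  unfolding depends_on_def by (metis assms)

lemma depends_onD: "depends_on K Y \<Longrightarrow> (\<And>i. i \<in> K \<Longrightarrow> \<omega> i = \<omega>' i) \<Longrightarrow> Y \<omega> = Y \<omega>'"
  unfolding depends_on_def by blast

lemma depends_on_mono: "depends_on K Y \<Longrightarrow> K \<subseteq> L \<Longrightarrow> depends_on L Y"
  unfolding depends_on_def by blast

lemma depends_on_conj: "depends_on K Y \<Longrightarrow> depends_on K Z \<Longrightarrow> depends_on K (\<lambda>\<omega>. Y \<omega> \<and> Z \<omega>)"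
  unfolding depends_on_def by blast

text \<open>
  The joint distribution of the coordinates is the product measure itself, hence the product of
  the marginal distributions.
\<close>

lemma indep_vars_PiM_pmf:
  fixes P :: "'i \<Rightarrow> 'a pmf" and I :: "'i set"
  assumes "I \<noteq> {}"
  defines "M \<equiv> PiM I (\<lambda>i. measure_pmf (P i))"
  shows "prob_space.indep_vars M (\<lambda>i. measure_pmf (P i)) (\<lambda>i \<omega>. \<omega> i) I"
proof -
  interpret prob_space M
    unfolding M_def by (intro prob_space_PiM measure_pmf.prob_space_axioms)
  have "distr M M (\<lambda>\<omega>. \<lambda>i\<in>I. \<omega> i) = distr M M (\<lambda>\<omega>. \<omega>)"
    by (rule distr_cong) (auto simp: M_def space_PiM PiE_def extensional_restrict)
  moreover have "PiM I (\<lambda>i. distr M (measure_pmf (P i)) (\<lambda>\<omega>. \<omega> i)) = M"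
    unfolding M_def
    by (intro PiM_cong refl distr_PiM_component measure_pmf.prob_space_axioms)
  ultimately show ?thesis
    by (subst indep_vars_iff_distr_eq_PiM') (use assms in \<open>auto simp: M_def\<close>)
qed

text \<open>
  The restrictions of a configuration to disjoint sets of coordinates are independent random
  variables, and each event is a function of one of them.
\<close>

lemma prob_Ball_depends_on:
  fixes P :: "'i \<Rightarrow> 'a pmf" and I :: "'i set"
  defines "M \<equiv> PiM I (\<lambda>i. measure_pmf (P i))"
  assumes J: "finite J" "\<And>j. j \<in> J \<Longrightarrow> K j \<subseteq> I" "disjoint_family_on K J"
    and Y: "\<And>j. j \<in> J \<Longrightarrow> Measurable.pred M (Y j)" "\<And>j. j \<in> J \<Longrightarrow> depends_on (K j) (Y j)"
  shows "measure M {\<omega> \<in> space M. \<forall>j\<in>J. Y j \<omega>} = (\<Prod>j\<in>J. measure M {\<omega> \<in> space M. Y j \<omega>})"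
proof -
  interpret prob_space M
    unfolding M_def by (intro prob_space_PiM measure_pmf.prob_space_axioms)
  let ?N = "\<lambda>j. PiM (K j) (\<lambda>i. measure_pmf (P i))"
  let ?r = "\<lambda>j \<omega>. restrict (\<lambda>i. \<omega> i) (K j)"
  \<comment> \<open>The restriction to \<open>K j\<close> is filled up to a full configuration, so that the event can be
     evaluated on it.\<close>
  define Y' where "Y' j \<omega> = Y j (\<lambda>i\<in>I. if i \<in> K j then \<omega> i else undefined)" for j \<omega>
  show ?thesis
  proof (cases "J = {} \<or> I = {}")
    case True
    then show ?thesis
    proof
      assume "I = {}"
      then have *: "space M = {\<lambda>i. undefined}" by (simp add: M_def space_PiM)
      have "measure M {\<lambda>i. undefined} = 1" using prob_space * by simp
      then have m: "measure M {\<omega> \<in> space M. Z \<omega>} = (if Z (\<lambda>i. undefined) then 1 else 0)" for Z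
        unfolding * by (auto simp: Collect_conv_if)
      show ?thesis unfolding m using J(1) by (induction J rule: finite_induct) auto
    qed (simp add: prob_space)
  next
    case False
    have iv: "indep_vars ?N ?r J"
      using indep_vars_restrict[OF indep_vars_PiM_pmf[of I P, folded M_def] J(2,3)] False by simp
    have Y'm: "Measurable.pred (?N j) (Y' j)" if "j \<in> J" for j
    proof -
      have "(\<lambda>\<omega>. \<lambda>i\<in>I. if i \<in> K j then \<omega> i else undefined) \<in> ?N j \<rightarrow>\<^sub>M M"
        unfolding M_def
      proof (rule measurable_restrict)
        fix i assume "i \<in> I"
        show "(\<lambda>\<omega>. if i \<in> K j then \<omega> i else undefined) \<in> ?N j \<rightarrow>\<^sub>M measure_pmf (P i)"
        proof (cases "i \<in> K j")
          case True
          then show ?thesis using measurable_component_singleton[OF True] by simp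
        qed simp
      qed
      from measurable_compose[OF this Y(1)[OF that]] show ?thesis
        by (simp add: Y'_def[abs_def])
    qed
    have Y'r: "Y' j (?r j \<omega>) = Y j \<omega>" if "j \<in> J" for j \<omega>
      unfolding Y'_def by (rule depends_onD[OF Y(2)[OF that]]) (use J(2)[OF that] in auto)
    have "prob (\<Inter>j\<in>J. ?r j -` {x \<in> space (?N j). Y' j x} \<inter> space M)
        = (\<Prod>j\<in>J. prob (?r j -` {x \<in> space (?N j). Y' j x} \<inter> space M))"
      by (rule indep_varsD_finite[OF iv]) (use False J(1) Y'm in auto)
    moreover have "?r j -` {x \<in> space (?N j). Y' j x} \<inter> space M = {\<omega> \<in> space M. Y j \<omega>}"
      if "j \<in> J" for j
      using that Y'r[OF that] by (auto simp: space_PiM)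
    moreover have "(\<Inter>j\<in>J. {\<omega> \<in> space M. Y j \<omega>}) = {\<omega> \<in> space M. \<forall>j\<in>J. Y j \<omega>}"
      using False by auto
    ultimately show ?thesis by (simp cong: INF_cong_simp prod.cong_simp del: vimage_Collect_eq INT_extend_simps INT_simps)
  qed
qed

lemma prob_conj_depends_on:
  fixes P :: "'i \<Rightarrow> 'a pmf" and I :: "'i set"
  defines "M \<equiv> PiM I (\<lambda>i. measure_pmf (P i))"
  assumes "K \<subseteq> I" "L \<subseteq> I" "K \<inter> L = {}"
    and "Measurable.pred M Y" "Measurable.pred M Z" "depends_on K Y" "depends_on L Z"
  shows "measure M {\<omega> \<in> space M. Y \<omega> \<and> Z \<omega>}
      = measure M {\<omega> \<in> space M. Y \<omega>} * measure M {\<omega> \<in> space M. Z \<omega>}"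
proof -
  have "measure M {\<omega> \<in> space M. \<forall>b\<in>UNIV. (if b then Y else Z) \<omega>}
      = (\<Prod>b\<in>UNIV. measure M {\<omega> \<in> space M. (if b then Y else Z) \<omega>})"
    unfolding M_def
    by (rule prob_Ball_depends_on[where K = "\<lambda>b. if b then K else L"])
      (use assms in \<open>auto simp: disjoint_family_on_def\<close>)
  moreover have "(\<forall>b\<in>UNIV. (if b then Y else Z) \<omega>) \<longleftrightarrow> Y \<omega> \<and> Z \<omega>" for \<omega>
    by (metis UNIV_I)
  ultimately show ?thesis by (simp add: UNIV_bool mult.commute)
qed

section \<open>Open paths in the tree with long edges\<close>

lemma vertices_iff: "v \<in> vertices d \<longleftrightarrow> set v \<subseteq> {1..d}"
  by (auto simp: vertices_def words_def)

lemma finite_words [simp]: "finite (words d n)"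
proof -
  have "words d n = {w. set w \<subseteq> {1..d} \<and> length w = n}" by (auto simp: words_def)
  then show ?thesis using finite_lists_length_eq[of "{1..d}" n] by simp
qed

lemma card_words: "card (words d n) = d ^ n"
proof -
  have "words d n = {w. set w \<subseteq> {1..d} \<and> length w = n}" by (auto simp: words_def)
  then show ?thesis using card_lists_length_eq[of "{1..d}" n] by simp
qed

lemma append_in_edges_iff:
  "(u, u @ w) \<in> edges d k \<longleftrightarrow> set u \<subseteq> {1..d} \<and> set w \<subseteq> {1..d} \<and> (length w = 1 \<or> length w = k)"
  by (auto simp: edges_def short_edges_def long_edges_def vertices_iff words_def length_Suc_conv)

lemma append_in_short_edges_iff:
  "(u, u @ w) \<in> short_edges d \<longleftrightarrow> set u \<subseteq> {1..d} \<and> set w \<subseteq> {1..d} \<and> length w = 1"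
  by (auto simp: short_edges_def vertices_iff length_Suc_conv)

lemma edges_appendE:
  assumes "(u, v) \<in> edges d k"
  obtains w where "v = u @ w" "set u \<subseteq> {1..d}" "set w \<subseteq> {1..d}" "length w = 1 \<or> length w = k"
  using assms by (auto simp: edges_def short_edges_def long_edges_def vertices_iff words_def)

abbreviation open_path :: "nat \<Rightarrow> nat \<Rightarrow> (edge \<Rightarrow> bool) \<Rightarrow> nat list \<Rightarrow> nat list \<Rightarrow> bool" where
  "open_path d k \<omega> u v \<equiv> (u, v) \<in> {e \<in> edges d k. \<omega> e}\<^sup>*"

lemma open_path_appendE:
  assumes "open_path d k \<omega> u v"
  obtains w where "v = u @ w" "set w \<subseteq> {1..d}"
proof -
  from assms have "\<exists>w. v = u @ w \<and> set w \<subseteq> {1..d}"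
  proof (induction rule: rtrancl_induct)
    case (step x y)
    then show ?case by (fastforce elim: edges_appendE)
  qed simp
  then show thesis using that by blast
qed

text \<open>
  Edges point away from the root, so a path to \<open>v\<close> stays in the levels up to that of \<open>v\<close>. The level
  of the end point of an edge therefore separates the past of a vertex from the edges that enter
  it.
\<close>

lemma depends_on_open_path:
  "depends_on {e \<in> edges d k. length (snd e) \<le> length v} (\<lambda>\<omega>. open_path d k \<omega> u v)"
proof (rule depends_onI)
  fix \<omega> \<omega>' :: "edge \<Rightarrow> bool"
  assume "open_path d k \<omega> u v"
    and "\<And>e. e \<in> {e \<in> edges d k. length (snd e) \<le> length v} \<Longrightarrow> \<omega> e = \<omega>' e"
  then show "open_path d k \<omega>' u v"
  proof (induction rule: rtrancl_induct)
    case (step x y)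
    from step.hyps(2) have xy: "(x, y) \<in> edges d k" "\<omega> (x, y)" by auto
    then have "length x \<le> length y" by (auto elim: edges_appendE)
    then have "open_path d k \<omega>' u x" using step.IH step.prems by simp
    moreover have "\<omega>' (x, y)" using step.prems[of "(x, y)"] xy by simp
    ultimately show ?case using xy by (auto intro: rtrancl.rtrancl_into_rtrancl)
  qed simp
qed

text \<open>
  The assumption \<open>k \<ge> 2\<close> keeps short and long edges apart: an edge that belonged to both sets
  would be open with probability \<open>p\<close> only.
\<close>

locale tree_percolation =
  fixes d k :: nat and p q :: real
  assumes k: "2 \<le> k" and p: "p \<in> {0..1}" and q: "q \<in> {0..1}"
begin

abbreviation "M \<equiv> percolation d k p q"

sublocale prob_space M
  unfolding percolation_def by (intro prob_space_PiM measure_pmf.prob_space_axioms)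

lemma pred_edge [measurable]: "Measurable.pred M (\<lambda>\<omega>. e \<in> {e \<in> edges d k. \<omega> e})"
proof (cases "e \<in> edges d k")
  case True
  have "(\<lambda>\<omega>. \<omega> e) \<in> M \<rightarrow>\<^sub>M measure_pmf (bernoulli_pmf (if e \<in> short_edges d then p else q))"
    unfolding percolation_def by (rule measurable_component_singleton[OF True])
  then show ?thesis using True by simp
qed simp

lemma pred_open [measurable]: "e \<in> edges d k \<Longrightarrow> Measurable.pred M (\<lambda>\<omega>. \<omega> e)"
  using pred_edge[of e] by simp

lemma pred_open_path [measurable]: "Measurable.pred M (\<lambda>\<omega>. open_path d k \<omega> u v)"
proof -
  have "Measurable.pred M (\<lambda>\<omega>. (u, v) \<in> {e \<in> edges d k. \<omega> e} ^^ n)" for n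
  proof (induction n arbitrary: v)
    case (Suc n)
    have "Measurable.pred M (\<lambda>\<omega>. \<exists>w. (u, w) \<in> {e \<in> edges d k. \<omega> e} ^^ n
            \<and> (w, v) \<in> {e \<in> edges d k. \<omega> e})"
      by (intro pred_intros_countable pred_intros_logic Suc.IH pred_edge)
    then show ?case by (simp add: relcomp_unfold)
  qed simp
  then show ?thesis unfolding rtrancl_power by (intro pred_intros_countable)
qed

lemma prob_conj:
  assumes "K \<subseteq> edges d k" "L \<subseteq> edges d k" "K \<inter> L = {}"
    and "Measurable.pred M Y" "Measurable.pred M Z" "depends_on K Y" "depends_on L Z"
  shows "prob {\<omega> \<in> space M. Y \<omega> \<and> Z \<omega>} = prob {\<omega> \<in> space M. Y \<omega>} * prob {\<omega> \<in> space M. Z \<omega>}"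
  unfolding percolation_def
  by (rule prob_conj_depends_on) (use assms in \<open>auto simp: percolation_def\<close>)

lemma prob_edge_open:
  assumes "e \<in> edges d k"
  shows "prob {\<omega> \<in> space M. \<omega> e} = (if e \<in> short_edges d then p else q)"
proof -
  let ?B = "measure_pmf (bernoulli_pmf (if e \<in> short_edges d then p else q))"
  have "distr M ?B (\<lambda>\<omega>. \<omega> e) = ?B"
    unfolding percolation_def
    by (rule distr_PiM_component) (use assms in \<open>auto intro: measure_pmf.prob_space_axioms\<close>)
  moreover have "measure (distr M ?B (\<lambda>\<omega>. \<omega> e)) {True} = prob ((\<lambda>\<omega>. \<omega> e) -` {True} \<inter> space M)"
    by (rule measure_distr) (use pred_open[OF assms] in auto)
  moreover have "(\<lambda>\<omega>. \<omega> e) -` {True} \<inter> space M = {\<omega> \<in> space M. \<omega> e}" by auto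
  moreover have "measure ?B {True} = (if e \<in> short_edges d then p else q)"
    using p q by (simp add: measure_pmf_single)
  ultimately show ?thesis by simp
qed

lemma take_edges:
  assumes v: "set v \<subseteq> {1..d}" and j: "l \<le> j" "j \<le> length v" and l: "l = 1 \<or> l = k"
  shows "(take (j - l) v, take j v) \<in> edges d k"
    and "(take (j - l) v, take j v) \<in> short_edges d \<longleftrightarrow> l = 1"
proof -
  let ?u = "take (j - l) v" and ?w = "drop (j - l) (take j v)"
  have split: "take j v = ?u @ ?w"
    by (metis append_take_drop_id diff_le_self min.absorb1 take_take)
  have w: "length ?w = l" using j by simp
  have s: "set ?u \<subseteq> {1..d}" "set ?w \<subseteq> {1..d}"
    using v set_take_subset[of _ v] set_drop_subset[of "j - l" "take j v"] by blast+
  show "(take (j - l) v, take j v) \<in> edges d k"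
    using append_in_edges_iff[of ?u ?w d k] s w l split by simp
  show "(take (j - l) v, take j v) \<in> short_edges d \<longleftrightarrow> l = 1"
    using append_in_short_edges_iff[of ?u ?w d] s w split by simp
qed

text \<open>
  The last edge of a path to a vertex is one of the two edges that enter it.
\<close>

lemma open_path_take_iff:
  assumes v: "set v \<subseteq> {1..d}" and j: "1 \<le> j" "j \<le> length v"
  shows "open_path d k \<omega> [] (take j v) \<longleftrightarrow>
     open_path d k \<omega> [] (take (j - 1) v) \<and> \<omega> (take (j - 1) v, take j v) \<or>
     k \<le> j \<and> open_path d k \<omega> [] (take (j - k) v) \<and> \<omega> (take (j - k) v, take j v)"
    (is "?L \<longleftrightarrow> ?R")
proof
  assume ?L
  then show ?R
  proof (cases rule: rtranclE)
    case base
    then show ?thesis using j by auto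
  next
    case (step u)
    then have e: "(u, take j v) \<in> edges d k" "\<omega> (u, take j v)" by auto
    then obtain w where w: "take j v = u @ w" "length w = 1 \<or> length w = k"
      by (auto elim: edges_appendE)
    have len: "length u + length w = j" using arg_cong[OF w(1), of length] j by simp
    have "u = take (length u) (take j v)" unfolding w(1) by simp
    then have "u = take (length u) v" using len by (simp add: min_def split: if_splits)
    then have "u = take (j - length w) v" using len by (metis add_diff_cancel_right')
    then show ?thesis using w(2) step e len by auto
  qed
next
  have "(take (j - l) v, take j v) \<in> edges d k" if "l \<le> j" "l = 1 \<or> l = k" for l
    using take_edges(1)[OF v that(1) j(2) that(2)] .
  then have *: "(take (j - l) v, take j v) \<in> {e \<in> edges d k. \<omega> e}"
    if "l \<le> j" "l = 1 \<or> l = k" "\<omega> (take (j - l) v, take j v)" for l using that by simp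
  assume ?R
  then show ?L using *[of 1] *[of k] j by (auto intro: rtrancl.rtrancl_into_rtrancl)
qed

text \<open>
  Inclusion and exclusion over the two edges that enter the vertex at level \<open>j\<close>. These edges are
  independent of each other and of everything that happens in the levels below \<open>j\<close>.
\<close>

lemma prob_conj_open_path_take:
  assumes v: "set v \<subseteq> {1..d}" and j: "1 \<le> j" "j \<le> length v"
    and Y [measurable]: "Measurable.pred M Y"
    and dep: "depends_on {e \<in> edges d k. length (snd e) < j} Y"
  defines "X \<equiv> \<lambda>i \<omega>. open_path d k \<omega> [] (take i v)"
  shows "prob {\<omega> \<in> space M. Y \<omega> \<and> X j \<omega>} =
      p * prob {\<omega> \<in> space M. Y \<omega> \<and> X (j - 1) \<omega>} +
      (if k \<le> j then q * prob {\<omega> \<in> space M. Y \<omega> \<and> X (j - k) \<omega>}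
         - p * q * prob {\<omega> \<in> space M. Y \<omega> \<and> X (j - 1) \<omega> \<and> X (j - k) \<omega>} else 0)"
proof -
  let ?K = "{e \<in> edges d k. length (snd e) < j}"
  let ?e = "\<lambda>l. (take (j - l) v, take j v)"
  have Xm [measurable]: "Measurable.pred M (X i)" for i
    unfolding X_def by measurable
  have Xd: "depends_on ?K (X i)" if "i < j" for i
    unfolding X_def by (rule depends_on_mono[OF depends_on_open_path]) (use that in auto)
  have edge: "prob {\<omega> \<in> space M. Z \<omega> \<and> \<omega> (?e l)} = prob {\<omega> \<in> space M. Z \<omega>} * (if l = 1 then p else q)"
    if "Measurable.pred M Z" "depends_on L Z" "L \<subseteq> edges d k" "?e l \<notin> L" "l \<le> j" "l = 1 \<or> l = k" for Z l L
  proof -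
    have e: "?e l \<in> edges d k" by (rule take_edges) (use v j that in auto)
    have "prob {\<omega> \<in> space M. Z \<omega> \<and> \<omega> (?e l)} = prob {\<omega> \<in> space M. Z \<omega>} * prob {\<omega> \<in> space M. \<omega> (?e l)}"
      by (rule prob_conj[where K = L and L = "{?e l}"])
        (use that e pred_open[OF e] in \<open>auto simp: depends_on_def\<close>)
    then show ?thesis
      using prob_edge_open[OF e] take_edges(2)[OF v \<open>l \<le> j\<close> j(2) that(6)] by simp
  qed
  have notK: "?e l \<notin> ?K" for l using j by simp
  have short: "prob {\<omega> \<in> space M. (Y \<omega> \<and> X (j - 1) \<omega>) \<and> \<omega> (?e 1)} = prob {\<omega> \<in> space M. Y \<omega> \<and> X (j - 1) \<omega>} * p"
    by (subst edge[of _ ?K]) (use notK j in \<open>auto intro!: depends_on_conj dep Xd\<close>)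
  show ?thesis
  proof (cases "k \<le> j")
    case True
    have [measurable]: "Measurable.pred M (\<lambda>\<omega>. \<omega> (?e 1))" "Measurable.pred M (\<lambda>\<omega>. \<omega> (?e k))"
      by (intro pred_open take_edges v True j; simp)+
    have long: "prob {\<omega> \<in> space M. (Y \<omega> \<and> X (j - k) \<omega>) \<and> \<omega> (?e k)} = prob {\<omega> \<in> space M. Y \<omega> \<and> X (j - k) \<omega>} * q"
      by (subst edge[of _ ?K]) (use notK j k True in \<open>auto intro!: depends_on_conj dep Xd\<close>)
    have "?e 1 \<noteq> ?e k"
    proof
      assume "?e 1 = ?e k"
      then have "length (take (j - 1) v) = length (take (j - k) v)" by simp
      then show False using k True j by simp
    qed
    then have "prob {\<omega> \<in> space M. ((Y \<omega> \<and> X (j - 1) \<omega> \<and> X (j - k) \<omega>) \<and> \<omega> (?e 1)) \<and> \<omega> (?e k)} =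
       prob {\<omega> \<in> space M. (Y \<omega> \<and> X (j - 1) \<omega> \<and> X (j - k) \<omega>) \<and> \<omega> (?e 1)} * q"
      by (subst edge[of _ "insert (?e 1) ?K"])
        (use notK j k True take_edges(1)[OF v j] in \<open>auto intro!: depends_on_conj
            depends_on_mono[OF dep] depends_on_mono[OF Xd], auto simp: depends_on_def\<close>)
    moreover have "prob {\<omega> \<in> space M. (Y \<omega> \<and> X (j - 1) \<omega> \<and> X (j - k) \<omega>) \<and> \<omega> (?e 1)} =
        prob {\<omega> \<in> space M. Y \<omega> \<and> X (j - 1) \<omega> \<and> X (j - k) \<omega>} * p"
      by (subst edge[of _ ?K]) (use notK j k True in \<open>auto intro!: depends_on_conj dep Xd\<close>)
    ultimately have both: "prob {\<omega> \<in> space M. ((Y \<omega> \<and> X (j - 1) \<omega> \<and> X (j - k) \<omega>) \<and> \<omega> (?e 1)) \<and> \<omega> (?e k)} =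
        p * q * prob {\<omega> \<in> space M. Y \<omega> \<and> X (j - 1) \<omega> \<and> X (j - k) \<omega>}" by simp
    let ?A = "{\<omega> \<in> space M. (Y \<omega> \<and> X (j - 1) \<omega>) \<and> \<omega> (?e 1)}"
    let ?B = "{\<omega> \<in> space M. (Y \<omega> \<and> X (j - k) \<omega>) \<and> \<omega> (?e k)}"
    have AB: "?A \<in> events" "?B \<in> events" by measurable
    have "{\<omega> \<in> space M. Y \<omega> \<and> X j \<omega>} = ?A \<union> ?B"
      unfolding X_def using open_path_take_iff[OF v j] True by auto
    then have "prob {\<omega> \<in> space M. Y \<omega> \<and> X j \<omega>} = prob ?A + prob ?B - prob (?A \<inter> ?B)"
      by (simp only: measure_Un3 fmeasurable_eq_sets AB)
    moreover have "?A \<inter> ?B = {\<omega> \<in> space M. ((Y \<omega> \<and> X (j - 1) \<omega> \<and> X (j - k) \<omega>) \<and> \<omega> (?e 1)) \<and> \<omega> (?e k)}"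
      by auto
    ultimately show ?thesis using short long both True by simp
  next
    case False
    have "{\<omega> \<in> space M. Y \<omega> \<and> X j \<omega>} = {\<omega> \<in> space M. (Y \<omega> \<and> X (j - 1) \<omega>) \<and> \<omega> (?e 1)}"
      unfolding X_def using open_path_take_iff[OF v j] False by auto
    then show ?thesis using short False by simp
  qed
qed

end

section \<open>Path weights and joint probabilities along a ray\<close>

text \<open>
  The total weight of all paths that climb \<open>n\<close> levels, where a short edge has weight \<open>p\<close> and a long
  edge has weight \<open>q\<close>; it is the expected number of open paths from a vertex to a given descendant
  \<open>n\<close> levels below it.
\<close>

fun path_weight :: "real \<Rightarrow> real \<Rightarrow> nat \<Rightarrow> nat \<Rightarrow> real" where
  "path_weight p q k n = (if n = 0 then 1 else p * path_weight p q k (n - 1)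
     + (if 0 < k \<and> k \<le> n then q * path_weight p q k (n - k) else 0))"

declare path_weight.simps [simp del]

lemma path_weight_0 [simp]: "path_weight p q k 0 = 1"
  by (simp add: path_weight.simps)

lemma path_weight_nonneg: "0 \<le> p \<Longrightarrow> 0 \<le> q \<Longrightarrow> 0 \<le> path_weight p q k n"
proof (induction n rule: less_induct)
  case (less n)
  then show ?case by (subst path_weight.simps) auto
qed

lemma path_weight_below: "n < k \<Longrightarrow> path_weight p q k n = p ^ n"
  by (induction n) (simp_all add: path_weight.simps[of p q k "Suc _"])

text \<open>
  The recursion has the supersolution \<open>1 / s^n\<close> as soon as \<open>p s + q s^k \<le> 1\<close>.
\<close>

lemma path_weight_le:
  assumes "0 \<le> p" "0 \<le> q" "0 < s" "p * s + q * s ^ k \<le> 1"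
  shows "path_weight p q k n \<le> 1 / s ^ n"
proof (induction n rule: less_induct)
  case (less n)
  show ?case
  proof (cases n)
    case (Suc m)
    have "p * path_weight p q k (n - 1) \<le> p * s / s ^ n"
      using mult_left_mono[OF less.IH[of m] assms(1)] assms(3) Suc by (simp add: field_simps)
    moreover have "(if 0 < k \<and> k \<le> n then q * path_weight p q k (n - k) else 0) \<le> q * s ^ k / s ^ n"
    proof (cases "0 < k \<and> k \<le> n")
      case True
      then have "q * path_weight p q k (n - k) \<le> q * (1 / s ^ (n - k))"
        using less.IH[of "n - k"] assms(2) by (intro mult_left_mono) auto
      then show ?thesis using True assms(3) by (simp add: power_diff)
    qed (use assms in auto)
    ultimately have "path_weight p q k n \<le> (p * s + q * s ^ k) / s ^ n"
      using Suc by (subst path_weight.simps) (simp add: add_divide_distrib)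
    also have "\<dots> \<le> 1 / s ^ n" using assms by (intro divide_right_mono) auto
    finally show ?thesis .
  qed simp
qed

text \<open>
  Extended by zero to negative levels, so that the recursion needs no case distinction.
\<close>

definition zpath_weight :: "real \<Rightarrow> real \<Rightarrow> nat \<Rightarrow> int \<Rightarrow> real" where
  "zpath_weight p q k z = (if z < 0 then 0 else path_weight p q k (nat z))"

lemma zpath_weight_nonneg: "0 \<le> p \<Longrightarrow> 0 \<le> q \<Longrightarrow> 0 \<le> zpath_weight p q k z"
  by (simp add: zpath_weight_def path_weight_nonneg)

lemma zpath_weight_rec:
  assumes "0 < k" "z \<noteq> 0"
  shows "zpath_weight p q k z = p * zpath_weight p q k (z - 1) + q * zpath_weight p q k (z - int k)"
proof (cases "z < 0")
  case False
  then have "nat (z - 1) = nat z - 1" "nat (z - int k) = nat z - k" by auto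
  then show ?thesis using False assms
    by (auto simp: zpath_weight_def path_weight.simps[of p q k "nat z"])
qed (simp add: zpath_weight_def)

lemma zpath_weight_super:
  assumes "0 < k" "0 \<le> p" "0 \<le> q"
  shows "p * zpath_weight p q k (z - 1) + q * zpath_weight p q k (z - int k) \<le> zpath_weight p q k z"
  using zpath_weight_rec[of k z p q] assms by (cases "z = 0") (auto simp: zpath_weight_def)

text \<open>
  A bound for the total weight of the pairs of paths that start together, climb \<open>x\<close> and \<open>y\<close> levels and
  do not meet again. If both are nonempty, one of them has to begin with a short edge and the other
  one with a long edge; the meetings after these first edges are allowed here, which only
  increases the weight.
\<close>

definition pair_weight :: "real \<Rightarrow> real \<Rightarrow> nat \<Rightarrow> int \<Rightarrow> int \<Rightarrow> real" where
  "pair_weight p q k x y =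
    (let B = zpath_weight p q k in
     if x < 0 \<or> y < 0 then 0 else if x = 0 then B y else if y = 0 then B x
     else p * q * (B (x - 1) * B (y - int k) + B (x - int k) * B (y - 1)))"

lemma pair_weight_sym: "pair_weight p q k x y = pair_weight p q k y x"
  by (auto simp: pair_weight_def Let_def)

lemma pair_weight_nonneg: "0 \<le> p \<Longrightarrow> 0 \<le> q \<Longrightarrow> 0 \<le> pair_weight p q k x y"
  by (auto simp: pair_weight_def Let_def zpath_weight_nonneg)

text \<open>
  Removing the last edge of the longer path is the recursion that joint probabilities satisfy in
  their larger index.
\<close>

lemma pair_weight_super:
  assumes k: "0 < k" and pq: "0 \<le> p" "0 \<le> q" and "x < y"
  shows "p * pair_weight p q k x (y - 1) + q * pair_weight p q k x (y - int k) \<le> pair_weight p q k x y"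
proof -
  let ?B = "zpath_weight p q k"
  note nn = zpath_weight_nonneg[OF pq]
  consider "x < 0" | "x = 0" | "0 < x" "y < int k" | "0 < x" "y = int k" | "0 < x" "int k < y" by linarith
  then show ?thesis
  proof cases
    case 1 then show ?thesis by (simp add: pair_weight_def)
  next
    case 2
    then have "pair_weight p q k x (y - 1) = ?B (y - 1)" "pair_weight p q k x y = ?B y"
      using \<open>x < y\<close> by (auto simp: pair_weight_def)
    moreover have "pair_weight p q k x (y - int k) = ?B (y - int k)"
      using 2 by (auto simp: pair_weight_def zpath_weight_def)
    ultimately show ?thesis using zpath_weight_super[OF k pq, of y] by simp
  next
    case 3
    then have "pair_weight p q k x (y - int k) = 0" "?B (y - int k) = 0" "?B (y - 1 - int k) = 0"
      by (auto simp: pair_weight_def zpath_weight_def)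
    moreover have "p * ?B (y - 2) \<le> ?B (y - 1)"
      using zpath_weight_super[OF k pq, of "y - 1"] mult_nonneg_nonneg[OF pq(2) nn] by (smt (verit))
    then have "(p * q * ?B (x - int k)) * (p * ?B (y - 2)) \<le> (p * q * ?B (x - int k)) * ?B (y - 1)"
      by (intro mult_left_mono) (use pq nn in auto)
    ultimately show ?thesis using 3 \<open>x < y\<close> by (simp add: pair_weight_def Let_def algebra_simps)
  next
    case 4
    then have "?B (x - int k) = 0" "?B (- 1) = 0" using \<open>x < y\<close> by (auto simp: zpath_weight_def)
    moreover have "?B x = p * ?B (x - 1)"
      using zpath_weight_rec[OF k, of x p q] 4 calculation by simp
    moreover have "?B 0 = 1" by (simp add: zpath_weight_def)
    ultimately show ?thesis using 4 \<open>x < y\<close> by (simp add: pair_weight_def Let_def algebra_simps)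
  next
    case 5
    have "p * ?B (y - int k - 1) + q * ?B (y - int k - int k) \<le> ?B (y - int k)"
      by (rule zpath_weight_super[OF k pq])
    from mult_left_mono[OF this, of "p * q * ?B (x - 1)"]
    have a: "p * q * ?B (x - 1) * (p * ?B (y - int k - 1) + q * ?B (y - int k - int k)) \<le> p * q * ?B (x - 1) * ?B (y - int k)"
      using pq nn by simp
    have "p * ?B (y - 1 - 1) + q * ?B (y - 1 - int k) \<le> ?B (y - 1)"
      by (rule zpath_weight_super[OF k pq])
    from mult_left_mono[OF this, of "p * q * ?B (x - int k)"]
    have b: "p * q * ?B (x - int k) * (p * ?B (y - 1 - 1) + q * ?B (y - 1 - int k)) \<le> p * q * ?B (x - int k) * ?B (y - 1)"
      using pq nn by simp
    have "y - 1 - int k = y - int k - 1" by simp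
    with add_mono[OF a b] show ?thesis using 5 \<open>x < y\<close>
      by (simp add: pair_weight_def Let_def algebra_simps)
  qed
qed

text \<open>
  Here \<open>c i j\<close> stands for the probability that the levels \<open>i\<close> and \<open>j\<close> of a ray are both reached. The
  recursion shortens the longer of the two paths until the two meet at a level \<open>m\<close>, which
  contributes \<open>c m m\<close>; the sum over all meeting levels is a supersolution by \<open>pair_weight_super\<close>.
\<close>

lemma joint_le_pair_weight:
  fixes c :: "nat \<Rightarrow> nat \<Rightarrow> real"
  assumes k: "0 < k" and pq: "0 \<le> p" "0 \<le> q"
    and sym: "\<And>i j. c i j = c j i" and nonneg: "\<And>i j. 0 \<le> c i j"
    and rec: "\<And>i j. i < j \<Longrightarrow> j \<le> n \<Longrightarrow>
        c i j \<le> p * c i (j - 1) + (if k \<le> j then q * c i (j - k) else 0)"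
    and "i \<le> n" "j \<le> n"
  shows "c i j \<le> (\<Sum>m\<le>n. c m m * pair_weight p q k (int i - int m) (int j - int m))"
  using \<open>i \<le> n\<close> \<open>j \<le> n\<close>
proof (induction "i + j" arbitrary: i j rule: less_induct)
  case less
  let ?h = "pair_weight p q k"
  note hn = pair_weight_nonneg[OF pq]
  have lt: "c i j \<le> (\<Sum>m\<le>n. c m m * ?h (int i - int m) (int j - int m))"
    if "i < j" "j \<le> n" and IH: "\<And>i' j'. i' + j' < i + j \<Longrightarrow> i' \<le> n \<Longrightarrow> j' \<le> n \<Longrightarrow>
       c i' j' \<le> (\<Sum>m\<le>n. c m m * ?h (int i' - int m) (int j' - int m))" for i j
  proof -
    have "c i j \<le> p * c i (j - 1) + (if k \<le> j then q * c i (j - k) else 0)"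
      by (rule rec[OF that(1,2)])
    also have "p * c i (j - 1) \<le> p * (\<Sum>m\<le>n. c m m * ?h (int i - int m) (int j - 1 - int m))"
      using IH[of i "j - 1"] that pq by (intro mult_left_mono) (auto simp: of_nat_diff)
    also have "(if k \<le> j then q * c i (j - k) else 0)
        \<le> q * (\<Sum>m\<le>n. c m m * ?h (int i - int m) (int j - int k - int m))"
    proof (cases "k \<le> j")
      case True
      then show ?thesis
        using IH[of i "j - k"] that pq k by (auto simp: of_nat_diff intro!: mult_left_mono)
    next
      case False
      then show ?thesis using pq hn nonneg by (auto intro!: mult_nonneg_nonneg sum_nonneg)
    qed
    also have "p * (\<Sum>m\<le>n. c m m * ?h (int i - int m) (int j - 1 - int m)) +
        q * (\<Sum>m\<le>n. c m m * ?h (int i - int m) (int j - int k - int m)) =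
        (\<Sum>m\<le>n. c m m * (p * ?h (int i - int m) (int j - int m - 1)
           + q * ?h (int i - int m) (int j - int m - int k)))"
      by (simp add: sum_distrib_left sum.distrib[symmetric] algebra_simps)
    also have "\<dots> \<le> (\<Sum>m\<le>n. c m m * ?h (int i - int m) (int j - int m))"
      by (intro sum_mono mult_left_mono pair_weight_super k pq nonneg) (use that in auto)
    finally show ?thesis by simp
  qed
  consider "i < j" | "j < i" | "i = j" by linarith
  then show ?case
  proof cases
    case 1
    then show ?thesis using lt less by blast
  next
    case 2
    have "c j i \<le> (\<Sum>m\<le>n. c m m * ?h (int j - int m) (int i - int m))"
    proof (rule lt)
      fix i' j' assume "i' + j' < j + i" "i' \<le> n" "j' \<le> n"
      then show "c i' j' \<le> (\<Sum>m\<le>n. c m m * ?h (int i' - int m) (int j' - int m))"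
        by (intro less.hyps) auto
    qed (use 2 less in auto)
    then show ?thesis using sym[of i j] pair_weight_sym[of p q k] by simp
  next
    case 3
    have "c i i * ?h (int i - int i) (int i - int i) \<le> (\<Sum>m\<le>n. c m m * ?h (int i - int m) (int i - int m))"
      by (rule member_le_sum) (use less 3 hn nonneg in auto)
    then show ?thesis using 3 by (simp add: pair_weight_def zpath_weight_def)
  qed
qed

text \<open>
  The dominant contributions to \<open>c (n - k) (n - 1)\<close>: the \<open>j\<close>-th summand belongs to a splitting at
  level \<open>n - k - j\<close>, with \<open>j\<close> short edges on one side and a long edge followed by \<open>j - 1\<close> short edges
  on the other one. The application takes \<open>t = p (1 - q)\<close>: short edges only count when the
  long edge to the same vertex is closed, which makes these events disjoint.
\<close>

lemma joint_ge_short_loops: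
  fixes c :: "nat \<Rightarrow> nat \<Rightarrow> real"
  assumes t: "0 \<le> t" and q: "0 \<le> q"
    and sym: "\<And>i j. c i j = c j i" and nonneg: "\<And>i j. 0 \<le> c i j"
    and rec: "\<And>i j. i < j \<Longrightarrow> j \<le> n \<Longrightarrow>
        t * c i (j - 1) + (if k \<le> j then q * c i (j - k) else 0) \<le> c i j"
    and J: "J < k" "k + J \<le> n"
  shows "(\<Sum>j=1..J. t ^ (2 * j - 1) * q * c (n - k - j) (n - k - j)) \<le> c (n - k) (n - 1)"
proof -
  \<comment> \<open>the side that consists of \<open>j\<close> short edges\<close>
  have diag: "t ^ j * c i i \<le> c i (i + j)" if "i + j \<le> n" for i j
    using that
  proof (induction j)
    case (Suc j)
    have "t ^ Suc j * c i i \<le> t * c i (i + j)" using Suc t by (simp add: mult.assoc mult_left_mono)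
    also have "\<dots> \<le> c i (i + Suc j)"
      using rec[of i "i + Suc j"] Suc.prems q nonneg[of i "i + Suc j - k"]
      by (auto split: if_splits) (smt (verit) mult_nonneg_nonneg)
    finally show ?case .
  qed simp
  \<comment> \<open>the other side: split off its last \<open>l\<close> short edges, and collect the cases in which a long
     edge comes before fewer than \<open>l\<close> of them\<close>
  have iter: "t ^ l * c (n - k) (n - 1 - l) + (\<Sum>i<l. t ^ i * q * c (n - k) (n - 1 - i - k)) \<le> c (n - k) (n - 1)"
    if "l \<le> J" for l
    using that
  proof (induction l)
    case (Suc l)
    have "t * c (n - k) (n - 1 - Suc l) + q * c (n - k) (n - 1 - l - k) \<le> c (n - k) (n - 1 - l)"
    proof -
      have "n - k < n - 1 - l" "n - 1 - l \<le> n" "k \<le> n - 1 - l" using Suc.prems J by linarith+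
      then show ?thesis using rec[of "n - k" "n - 1 - l"] by simp
    qed
    from mult_left_mono[OF this, of "t ^ l"]
    have "t ^ Suc l * c (n - k) (n - 1 - Suc l) + t ^ l * q * c (n - k) (n - 1 - l - k)
        \<le> t ^ l * c (n - k) (n - 1 - l)"
      using t by (simp add: algebra_simps)
    then show ?case using Suc by simp
  qed simp
  have "(\<Sum>j=1..J. t ^ (2 * j - 1) * q * c (n - k - j) (n - k - j))
      = (\<Sum>i<J. t ^ (2 * i + 1) * q * c (n - k - Suc i) (n - k - Suc i))"
    by (simp add: sum.atLeast1_atMost_eq)
  also have "\<dots> \<le> (\<Sum>i<J. t ^ i * q * c (n - k) (n - 1 - i - k))"
  proof (rule sum_mono)
    fix i assume i: "i \<in> {..<J}"
    have "t ^ Suc i * c (n - k - Suc i) (n - k - Suc i) \<le> c (n - k - Suc i) (n - k - Suc i + Suc i)"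
      using i J by (intro diag) auto
    also have "\<dots> = c (n - k) (n - 1 - i - k)"
      using i J by (subst sym) (auto intro!: arg_cong2[where f = c])
    finally have "(t ^ i * q) * (t ^ Suc i * c (n - k - Suc i) (n - k - Suc i)) \<le> (t ^ i * q) * c (n - k) (n - 1 - i - k)"
      using t q by (intro mult_left_mono) auto
    then show "t ^ (2 * i + 1) * q * c (n - k - Suc i) (n - k - Suc i) \<le> t ^ i * q * c (n - k) (n - 1 - i - k)"
      by (simp add: power_add mult_2 mult.assoc mult.left_commute)
  qed
  also have "\<dots> \<le> t ^ J * c (n - k) (n - 1 - J) + (\<Sum>i<J. t ^ i * q * c (n - k) (n - 1 - i - k))"
    using t nonneg by simp
  also have "\<dots> \<le> c (n - k) (n - 1)" by (rule iter) simp
  finally show ?thesis .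
qed

section \<open>Linear recursions with a quadratic loss\<close>

lemma sum_lag:
  fixes z :: "nat \<Rightarrow> 'a::comm_monoid_add"
  assumes "l \<le> N"
  shows "(\<Sum>n=l..N. z (n - l)) = (\<Sum>n\<le>N - l. z n)"
  by (rule sum.reindex_bij_witness[of _ "\<lambda>n. n + l" "\<lambda>n. n - l"]) (use assms in auto)

text \<open>
  If the weights \<open>P\<close>, \<open>Q\<close> and \<open>- w j\<close> sum to less than one, comparing partial sums should bound
  them. The negative weights need care, since they belong to the larger lags \<open>k + j\<close> and hence to
  smaller partial sums. But partial sums grow by at most a factor \<open>1 + x\<close> per step, up to an
  additive constant, so these lags may be replaced by \<open>k\<close> at the cost of the factors
  \<open>(1 + x)^j\<close>.
\<close>

lemma partial_sums_bounded_if_subcritical: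
  fixes z :: "nat \<Rightarrow> real"
  assumes z: "z 0 \<le> 1" "\<And>n. 0 \<le> z n" and P: "0 \<le> P" "P < 1" and Q: "0 \<le> Q" and x: "0 \<le> x" "P + Q \<le> 1 + x"
    and k: "0 < k"
    and rec1: "\<And>n. 0 < n \<Longrightarrow> z n \<le> P * z (n - 1) + (if k \<le> n then Q * z (n - k) else 0)"
    and rec2: "\<And>n. k + J \<le> n \<Longrightarrow>
        z n \<le> P * z (n - 1) + Q * z (n - k) - (\<Sum>j=1..J. w j * z (n - k - j))"
    and w: "\<And>j. 0 \<le> w j"
    and sub: "P + Q - (\<Sum>j=1..J. w j / (1 + x) ^ j) < 1"
  shows "\<exists>B. \<forall>N. (\<Sum>n\<le>N. z n) \<le> B"
proof -
  define Z where "Z N = (\<Sum>n\<le>N. z n)" for N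
  have Z0: "0 \<le> Z N" for N unfolding Z_def by (intro sum_nonneg z)
  have mono: "Z M \<le> Z N" if "M \<le> N" for M N
    unfolding Z_def by (rule sum_mono2) (use that z in auto)
  have grow: "Z (Suc M) \<le> 1 + (1 + x) * Z M" for M
  proof -
    have "Z (Suc M) = z 0 + (\<Sum>n=1..Suc M. z n)"
      unfolding Z_def by (simp add: atMost_atLeast0 sum.atLeast_Suc_atMost)
    also have "(\<Sum>n=1..Suc M. z n) \<le> (\<Sum>n=1..Suc M. P * z (n - 1) + (if k \<le> n then Q * z (n - k) else 0))"
      by (intro sum_mono rec1) auto
    also have "\<dots> = P * (\<Sum>n=1..Suc M. z (n - 1)) + (\<Sum>n=1..Suc M. if k \<le> n then Q * z (n - k) else 0)"
      by (simp only: sum.distrib sum_distrib_left)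
    also have "(\<Sum>n=1..Suc M. z (n - 1)) = Z M"
      using sum_lag[of 1 "Suc M" z] by (simp add: Z_def)
    also have "(\<Sum>n=1..Suc M. if k \<le> n then Q * z (n - k) else 0) = (\<Sum>n=k..Suc M. Q * z (n - k))"
      by (rule sum.mono_neutral_cong_right) (use k in auto)
    also have "\<dots> \<le> Q * Z M"
    proof (cases "k \<le> Suc M")
      case True
      then have "(\<Sum>n=k..Suc M. Q * z (n - k)) = Q * Z (Suc M - k)"
        using sum_lag[OF True, of z] by (simp add: Z_def sum_distrib_left[symmetric])
      then show ?thesis using mono[of "Suc M - k" M] Q k by (simp add: mult_left_mono)
    qed (use Q Z0 in simp)
    finally have "Z (Suc M) \<le> 1 + (P + Q) * Z M" using z by (simp add: algebra_simps)
    also have "\<dots> \<le> 1 + (1 + x) * Z M" using mult_right_mono[OF x(2) Z0[of M]] by simp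
    finally show ?thesis .
  qed
  have grow_iter: "Z (M + j) \<le> (1 + x) ^ j * (Z M + j)" for M j
  proof (induction j)
    case (Suc j)
    have "Z (M + Suc j) \<le> 1 + (1 + x) * Z (M + j)" using grow[of "M + j"] by simp
    also have "\<dots> \<le> 1 + (1 + x) * ((1 + x) ^ j * (Z M + j))"
      using Suc x by (intro add_left_mono mult_left_mono) auto
    also have "\<dots> = 1 + (1 + x) ^ Suc j * (Z M + j)" by simp
    also have "\<dots> \<le> (1 + x) ^ Suc j + (1 + x) ^ Suc j * (Z M + j)"
      using one_le_power[of "1 + x" "Suc j"] x by linarith
    also have "\<dots> = (1 + x) ^ Suc j * (Z M + real (Suc j))" by (simp add: algebra_simps)
    finally show ?case .
  qed simp
  define K where "K = Z (k + J) + (\<Sum>j=1..J. w j * (j + Z J))"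
  define R where "R = Q - (\<Sum>j=1..J. w j / (1 + x) ^ j)"
  have main: "Z N \<le> K + P * Z N + R * Z (N - k)" if N: "k + J \<le> N" for N
  proof -
    have "Z N = (\<Sum>n<k + J. z n) + (\<Sum>n=k+J..N. z n)"
      unfolding Z_def using N by (subst sum.union_disjoint[symmetric]) (auto intro!: sum.cong)
    also have "(\<Sum>n<k + J. z n) \<le> Z (k + J)" unfolding Z_def by (rule sum_mono2) (use z in auto)
    also have "(\<Sum>n=k+J..N. z n) \<le> (\<Sum>n=k+J..N. P * z (n - 1) + Q * z (n - k) - (\<Sum>j=1..J. w j * z (n - k - j)))"
      by (intro sum_mono rec2) auto
    also have "\<dots> = P * (\<Sum>n=k+J..N. z (n - 1)) + Q * (\<Sum>n=k+J..N. z (n - k))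
        - (\<Sum>j=1..J. w j * (\<Sum>n=k+J..N. z (n - k - j)))"
    proof -
      have "(\<Sum>n=k+J..N. \<Sum>j=1..J. w j * z (n - k - j)) = (\<Sum>j=1..J. w j * (\<Sum>n=k+J..N. z (n - k - j)))"
        by (subst sum.swap) (simp add: sum_distrib_left)
      then show ?thesis by (simp add: sum.distrib sum_subtractf sum_distrib_left)
    qed
    also have "P * (\<Sum>n=k+J..N. z (n - 1)) \<le> P * Z N"
    proof (rule mult_left_mono[OF _ P(1)])
      have "(\<Sum>n=k+J..N. z (n - 1)) \<le> (\<Sum>n=1..N. z (n - 1))"
        by (rule sum_mono2) (use k z in auto)
      also have "\<dots> = Z (N - 1)" using sum_lag[of 1 N z] N k by (simp add: Z_def)
      also have "\<dots> \<le> Z N" by (rule mono) simp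
      finally show "(\<Sum>n=k+J..N. z (n - 1)) \<le> Z N" .
    qed
    also have "Q * (\<Sum>n=k+J..N. z (n - k)) \<le> Q * Z (N - k)"
    proof (rule mult_left_mono[OF _ Q])
      have "(\<Sum>n=k+J..N. z (n - k)) \<le> (\<Sum>n=k..N. z (n - k))"
        by (rule sum_mono2) (use k z in auto)
      also have "\<dots> = Z (N - k)" using sum_lag[of k N z] N by (simp add: Z_def)
      finally show "(\<Sum>n=k+J..N. z (n - k)) \<le> Z (N - k)" .
    qed
    finally have "Z N \<le> Z (k + J) + (P * Z N + Q * Z (N - k)
        - (\<Sum>j=1..J. w j * (\<Sum>n=k+J..N. z (n - k - j))))" by simp
    moreover have "(\<Sum>j=1..J. w j * (\<Sum>n=k+J..N. z (n - k - j))) \<ge> (\<Sum>j=1..J. w j * (Z (N - k) / (1 + x) ^ j - (j + Z J)))"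
    proof (intro sum_mono mult_left_mono w)
      fix j assume j: "j \<in> {1..J}"
      have "Z (N - k) \<le> (1 + x) ^ j * (Z (N - k - j) + j)"
        using grow_iter[of "N - k - j" j] N j by simp
      then have "Z (N - k) / (1 + x) ^ j \<le> Z (N - k - j) + j"
        using x by (simp add: field_simps)
      also have "Z (N - k - j) = (\<Sum>n=k+j..N. z (n - (k + j)))"
        using sum_lag[of "k + j" N z] N j by (simp add: Z_def)
      also have "\<dots> = (\<Sum>n=k+j..<k+J. z (n - (k + j))) + (\<Sum>n=k+J..N. z (n - (k + j)))"
        using N j by (subst sum.union_disjoint[symmetric]) (auto intro!: sum.cong)
      also have "(\<Sum>n=k+j..<k+J. z (n - (k + j))) \<le> Z J"
      proof -
        have "(\<Sum>n=k+j..<k+J. z (n - (k + j))) = (\<Sum>m<J - j. z m)"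
          by (rule sum.reindex_bij_witness[of _ "\<lambda>m. m + (k + j)" "\<lambda>n. n - (k + j)"]) auto
        also have "\<dots> \<le> Z J" unfolding Z_def by (rule sum_mono2) (use z in auto)
        finally show ?thesis .
      qed
      finally show "Z (N - k) / (1 + x) ^ j - (j + Z J) \<le> (\<Sum>n=k+J..N. z (n - k - j))" by simp
    qed
    moreover have "(\<Sum>j=1..J. w j * (Z (N - k) / (1 + x) ^ j - (j + Z J))) =
        (\<Sum>j=1..J. w j / (1 + x) ^ j) * Z (N - k) - (\<Sum>j=1..J. w j * (j + Z J))"
      by (simp add: right_diff_distrib sum_subtractf sum_distrib_right)
    ultimately show ?thesis by (simp add: K_def R_def left_diff_distrib)
  qed
  define T where "T = 1 - P - max R 0"
  have T: "0 < T" using sub P by (simp add: T_def R_def max_def)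
  have bound: "Z N \<le> K / T" if N: "k + J \<le> N" for N
  proof -
    have "R * Z (N - k) \<le> max R 0 * Z N"
      using mult_mono[of R "max R 0" "Z (N - k)" "Z N"] mono[of "N - k" N] Z0 by simp
    with main[OF N] have "T * Z N \<le> K" by (simp add: T_def algebra_simps)
    then show ?thesis using T by (simp add: field_simps)
  qed
  have "Z N \<le> K / T" for N
    using mono[of N "N + (k + J)"] bound[of "N + (k + J)"] by simp
  then show ?thesis unfolding Z_def by blast
qed

text \<open>
  If no term exceeds one, a lag changes partial sums only by a constant; since the total weight
  \<open>P + Q - G\<close> exceeds one, the partial sums are then bounded and converge to some \<open>L\<close>. Summing the
  recursion over all levels gives \<open>1 + (P + Q - G) L \<le> L\<close>, which is absurd for \<open>L \<ge> 0\<close>.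
\<close>

lemma exceeds_one_if_supercritical:
  fixes z :: "nat \<Rightarrow> real"
  assumes z: "z 0 = 1" "\<And>n. 0 \<le> z n" and P: "0 \<le> P" "P < 1" and k: "0 < k"
    and rec: "\<And>n. 0 < n \<Longrightarrow> P * z (n - 1) +
       (if k \<le> n then Q * z (n - k) - (\<Sum>m\<le>n - k. z m * g (n - k - m)) else 0) \<le> z n"
    and g: "\<And>n. 0 \<le> g n" "\<And>N. (\<Sum>n\<le>N. g n) \<le> G"
    and super: "1 < P + Q - G"
  shows "\<exists>n>0. 1 < z n"
proof (rule ccontr)
  assume "\<not> ?thesis"
  then have z1: "z n \<le> 1" for n using z(1) by (metis gr0I not_le order_refl)
  define Z where "Z N = (\<Sum>n\<le>N. z n)" for N
  have Z0: "0 \<le> Z N" for N unfolding Z_def by (intro sum_nonneg z)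
  have mono: "Z M \<le> Z N" if "M \<le> N" for M N
    unfolding Z_def by (rule sum_mono2) (use that z in auto)
  have conv: "(\<Sum>r\<le>R. \<Sum>m\<le>r. z m * g (r - m)) \<le> G * Z R" for R
  proof -
    have "(\<Sum>r\<le>R. \<Sum>m\<le>r. z m * g (r - m)) = (\<Sum>(m, l)\<in>{(m, l). m + l \<le> R}. z m * g l)"
      by (simp add: sum.triangle_reindex_eq)
    also have "\<dots> \<le> (\<Sum>(m, l)\<in>{..R} \<times> {..R}. z m * g l)"
      by (rule sum_mono2) (use z g in auto)
    also have "\<dots> = (\<Sum>m\<le>R. z m * (\<Sum>l\<le>R. g l))"
      by (simp add: sum.cartesian_product[symmetric] sum_distrib_left)
    also have "\<dots> \<le> (\<Sum>m\<le>R. z m * G)"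
      by (intro sum_mono mult_left_mono g z)
    finally show ?thesis by (simp add: Z_def sum_distrib_left mult.commute)
  qed
  have main: "1 + P * Z (N - 1) + (Q - G) * Z (N - k) \<le> Z N" if N: "k \<le> N" for N
  proof -
    let ?s = "\<lambda>n. \<Sum>m\<le>n - k. z m * g (n - k - m)"
    have "Z N = z 0 + (\<Sum>n=1..N. z n)"
      unfolding Z_def using N k by (subst atMost_atLeast0, subst sum.atLeast_Suc_atMost) auto
    moreover have "(\<Sum>n=1..N. P * z (n - 1) + (if k \<le> n then Q * z (n - k) - ?s n else 0)) \<le> (\<Sum>n=1..N. z n)"
      by (intro sum_mono rec) auto
    moreover have "(\<Sum>n=1..N. P * z (n - 1) + (if k \<le> n then Q * z (n - k) - ?s n else 0))
        = P * (\<Sum>n=1..N. z (n - 1)) + (\<Sum>n=1..N. if k \<le> n then Q * z (n - k) - ?s n else 0)"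
      by (simp only: sum.distrib sum_distrib_left)
    moreover have "(\<Sum>n=1..N. z (n - 1)) = Z (N - 1)"
      using sum_lag[of 1 N z] N k by (simp add: Z_def)
    moreover have "(\<Sum>n=1..N. if k \<le> n then Q * z (n - k) - ?s n else 0) = (\<Sum>n=k..N. Q * z (n - k) - ?s n)"
      by (rule sum.mono_neutral_cong_right) (use k in auto)
    moreover have "\<dots> = Q * Z (N - k) - (\<Sum>r\<le>N - k. \<Sum>m\<le>r. z m * g (r - m))"
      using sum_lag[OF N, of z] sum_lag[OF N, of "\<lambda>r. \<Sum>m\<le>r. z m * g (r - m)"]
      by (simp add: Z_def sum_subtractf sum_distrib_left[symmetric])
    ultimately show ?thesis using conv[of "N - k"] z by (simp add: algebra_simps)
  qed
  define e where "e = P + Q - G - 1"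
  have e: "0 < e" using super by (simp add: e_def)
  have lagle: "Z N \<le> Z (N - l) + l" if "l \<le> N" for N l
  proof -
    have "Z N = Z (N - l) + (\<Sum>n=Suc (N - l)..N. z n)"
      unfolding Z_def using that by (subst sum.union_disjoint[symmetric]) (auto intro!: sum.cong)
    also have "(\<Sum>n=Suc (N - l)..N. z n) \<le> (\<Sum>n=Suc (N - l)..N. 1)" by (intro sum_mono z1)
    finally show ?thesis using that by simp
  qed
  have bounded: "Z N \<le> (P + (Q - G) * k) / e" if N: "k \<le> N" for N
  proof -
    have "P * (Z N - 1) \<le> P * Z (N - 1)" using lagle[of 1 N] N k P by (intro mult_left_mono) auto
    moreover have "(Q - G) * (Z N - k) \<le> (Q - G) * Z (N - k)"
      using lagle[OF N] super P by (intro mult_left_mono) auto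
    ultimately have "e * Z N \<le> P + (Q - G) * k" using main[OF N] by (simp add: e_def algebra_simps)
    then show ?thesis using e by (simp add: field_simps)
  qed
  have "Z N \<le> (P + (Q - G) * k) / e" for N
    using mono[of N "N + k"] bounded[of "N + k"] by simp
  moreover have inc: "incseq Z" using mono by (simp add: incseq_def)
  ultimately obtain L where L: "Z \<longlonglongrightarrow> L" using incseq_convergent[of Z] by blast
  have shift: "(\<lambda>N. Z (N - l)) \<longlonglongrightarrow> L" for l
    by (rule LIMSEQ_offset[where k = l]) (use L in simp)
  have "1 + P * L + (Q - G) * L \<le> L"
  proof (rule LIMSEQ_le)
    show "(\<lambda>N. 1 + P * Z (N - 1) + (Q - G) * Z (N - k)) \<longlonglongrightarrow> 1 + P * L + (Q - G) * L"
      by (intro tendsto_intros shift)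
    show "\<exists>M. \<forall>N\<ge>M. 1 + P * Z (N - 1) + (Q - G) * Z (N - k) \<le> Z N" using main by blast
  qed (rule L)
  then have "e * L \<le> - 1" by (simp add: e_def algebra_simps)
  moreover have "0 \<le> L" using LIMSEQ_le_const[OF L] Z0 by blast
  ultimately show False using e by (smt (verit) mult_nonneg_nonneg)
qed

section \<open>Mean number of cluster vertices per level\<close>

lemma sum_words_take:
  fixes g :: "nat list \<Rightarrow> real"
  assumes "m \<le> n"
  shows "(\<Sum>v\<in>words d n. g (take m v)) = real d ^ (n - m) * (\<Sum>u\<in>words d m. g u)"
proof -
  have "(\<Sum>v\<in>words d n. g (take m v)) = (\<Sum>(u, w)\<in>words d m \<times> words d (n - m). g u)"
    by (rule sum.reindex_bij_witness[of _ "\<lambda>(u, w). u @ w" "\<lambda>v. (take m v, drop m v)"])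
      (use assms in \<open>auto simp: words_def dest: in_set_takeD in_set_dropD\<close>)
  also have "\<dots> = real d ^ (n - m) * (\<Sum>u\<in>words d m. g u)"
    by (simp add: sum.cartesian_product[symmetric] card_words sum_distrib_left)
  finally show ?thesis .
qed

context tree_percolation
begin

definition level_mean :: "nat \<Rightarrow> real" where
  "level_mean n = (\<Sum>v\<in>words d n. prob {\<omega> \<in> space M. open_path d k \<omega> [] v})"

definition joint :: "nat list \<Rightarrow> nat \<Rightarrow> nat \<Rightarrow> real" where
  "joint v i j = prob {\<omega> \<in> space M. open_path d k \<omega> [] (take i v) \<and> open_path d k \<omega> [] (take j v)}"

lemma joint_sym: "joint v i j = joint v j i"
  by (simp add: joint_def conj_commute)

lemma joint_nonneg: "0 \<le> joint v i j"
  by (simp add: joint_def)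

lemma level_mean_nonneg: "0 \<le> level_mean n"
  by (simp add: level_mean_def sum_nonneg)

lemma level_mean_0: "level_mean 0 = 1"
proof -
  have "words d 0 = {[]}" by (auto simp: words_def)
  then show ?thesis by (simp add: level_mean_def prob_space)
qed

lemma sum_words_joint:
  assumes "m \<le> n"
  shows "(\<Sum>v\<in>words d n. joint v m m) = real d ^ (n - m) * level_mean m"
  using sum_words_take[OF assms, of "\<lambda>u. prob {\<omega> \<in> space M. open_path d k \<omega> [] u}" d]
  by (simp add: joint_def level_mean_def)

lemma joint_diag_rec:
  assumes "v \<in> words d n" "0 < n"
  shows "joint v n n = p * joint v (n - 1) (n - 1)
     + (if k \<le> n then q * joint v (n - k) (n - k) - p * q * joint v (n - k) (n - 1) else 0)"
  using prob_conj_open_path_take[of v n "\<lambda>_. True"] assms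
  by (simp add: joint_def words_def depends_on_def conj_commute)

text \<open>
  Inclusion and exclusion with the correction term estimated in two ways: it is nonnegative, and
  it is at most \<open>p q\<close> times the probability that the levels \<open>i\<close> and \<open>j - 1\<close> are reached.
\<close>

lemma joint_rec:
  assumes "v \<in> words d n" "i < j" "j \<le> n"
  shows "joint v i j \<le> p * joint v i (j - 1) + (if k \<le> j then q * joint v i (j - k) else 0)"
    and "p * (1 - q) * joint v i (j - 1) + (if k \<le> j then q * joint v i (j - k) else 0) \<le> joint v i j"
proof -
  let ?X = "\<lambda>i \<omega>. open_path d k \<omega> [] (take i v)"
  let ?t = "prob {\<omega> \<in> space M. ?X i \<omega> \<and> ?X (j - 1) \<omega> \<and> ?X (j - k) \<omega>}"
  have "depends_on {e \<in> edges d k. length (snd e) < j} (?X i)"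
    by (rule depends_on_mono[OF depends_on_open_path]) (use assms in auto)
  then have eq: "joint v i j = p * joint v i (j - 1)
      + (if k \<le> j then q * joint v i (j - k) - p * q * ?t else 0)"
    using prob_conj_open_path_take[of v j "?X i"] assms by (simp add: joint_def words_def)
  have "?t \<le> joint v i (j - 1)"
    unfolding joint_def by (rule finite_measure_mono) auto
  then have t: "0 \<le> p * q * ?t" "p * q * ?t \<le> p * q * joint v i (j - 1)"
    using p q by (auto intro!: mult_left_mono mult_nonneg_nonneg)
  have "0 \<le> p * q * joint v i (j - 1)" using p q joint_nonneg by simp
  then show "joint v i j \<le> p * joint v i (j - 1) + (if k \<le> j then q * joint v i (j - k) else 0)"
    "p * (1 - q) * joint v i (j - 1) + (if k \<le> j then q * joint v i (j - k) else 0) \<le> joint v i j"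
    using t eq by (auto simp: algebra_simps)
qed

lemma level_mean_le:
  assumes "0 < n"
  shows "level_mean n \<le> p * real d * level_mean (n - 1)
    + (if k \<le> n then q * real d ^ k * level_mean (n - k) else 0)"
proof -
  have "level_mean n = (\<Sum>v\<in>words d n. joint v n n)" using sum_words_joint[of n n] by simp
  also have "\<dots> \<le> (\<Sum>v\<in>words d n. p * joint v (n - 1) (n - 1)
      + (if k \<le> n then q * joint v (n - k) (n - k) else 0))"
    using joint_diag_rec assms p q joint_nonneg by (intro sum_mono) (auto simp: mult_nonneg_nonneg)
  also have "\<dots> = p * (\<Sum>v\<in>words d n. joint v (n - 1) (n - 1))
      + (if k \<le> n then q * (\<Sum>v\<in>words d n. joint v (n - k) (n - k)) else 0)"
    by (simp add: sum.distrib sum_distrib_left)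
  finally show ?thesis using assms by (simp add: sum_words_joint split: if_splits)
qed

text \<open>
  The \<open>j\<close>-th summand accounts for the vertices at level \<open>n\<close> that are entered twice because of a
  loop that starts at level \<open>n - k - j\<close>; a vertex of that level has \<open>d^(k + j)\<close> descendants at
  level \<open>n\<close>.
\<close>

lemma level_mean_le_loops:
  assumes J: "J < k" "k + J \<le> n"
  shows "level_mean n \<le> p * real d * level_mean (n - 1) + q * real d ^ k * level_mean (n - k)
    - (\<Sum>j=1..J. p * q * (p * (1 - q)) ^ (2 * j - 1) * q * real d ^ (k + j) * level_mean (n - k - j))"
proof -
  let ?t = "p * (1 - q)"
  have n: "0 < n" "k \<le> n" using J by auto
  have "level_mean n = (\<Sum>v\<in>words d n. joint v n n)" using sum_words_joint[of n n] by simp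
  also have "\<dots> \<le> (\<Sum>v\<in>words d n. p * joint v (n - 1) (n - 1) + q * joint v (n - k) (n - k)
      - p * q * (\<Sum>j=1..J. ?t ^ (2 * j - 1) * q * joint v (n - k - j) (n - k - j)))"
  proof (rule sum_mono)
    fix v assume v: "v \<in> words d n"
    have "(\<Sum>j=1..J. ?t ^ (2 * j - 1) * q * joint v (n - k - j) (n - k - j)) \<le> joint v (n - k) (n - 1)"
      by (rule joint_ge_short_loops) (use p q joint_sym joint_nonneg joint_rec(2)[OF v] J in auto)
    then have "p * q * (\<Sum>j=1..J. ?t ^ (2 * j - 1) * q * joint v (n - k - j) (n - k - j))
        \<le> p * q * joint v (n - k) (n - 1)"
      by (intro mult_left_mono) (use p q in auto)
    then show "joint v n n \<le> p * joint v (n - 1) (n - 1) + q * joint v (n - k) (n - k)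
      - p * q * (\<Sum>j=1..J. ?t ^ (2 * j - 1) * q * joint v (n - k - j) (n - k - j))"
      using joint_diag_rec[OF v n(1)] n by simp
  qed
  also have "\<dots> = p * (\<Sum>v\<in>words d n. joint v (n - 1) (n - 1)) + q * (\<Sum>v\<in>words d n. joint v (n - k) (n - k))
      - p * q * (\<Sum>j=1..J. ?t ^ (2 * j - 1) * q * (\<Sum>v\<in>words d n. joint v (n - k - j) (n - k - j)))"
  proof -
    have "(\<Sum>v\<in>words d n. \<Sum>j=1..J. ?t ^ (2 * j - 1) * q * joint v (n - k - j) (n - k - j))
        = (\<Sum>j=1..J. ?t ^ (2 * j - 1) * q * (\<Sum>v\<in>words d n. joint v (n - k - j) (n - k - j)))"
      by (subst sum.swap) (simp add: sum_distrib_left)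
    then show ?thesis by (simp only: sum.distrib sum_subtractf sum_distrib_left[symmetric])
  qed
  also have "p * q * (\<Sum>j=1..J. ?t ^ (2 * j - 1) * q * (\<Sum>v\<in>words d n. joint v (n - k - j) (n - k - j)))
      = (\<Sum>j=1..J. p * q * ?t ^ (2 * j - 1) * q * real d ^ (k + j) * level_mean (n - k - j))"
    unfolding sum_distrib_left[of "p * q"]
  proof (rule sum.cong[OF refl])
    fix j assume "j \<in> {1..J}"
    then have "n - (n - k - j) = k + j" using J by auto
    then show "p * q * (?t ^ (2 * j - 1) * q * (\<Sum>v\<in>words d n. joint v (n - k - j) (n - k - j)))
        = p * q * ?t ^ (2 * j - 1) * q * real d ^ (k + j) * level_mean (n - k - j)"
      using sum_words_joint[of "n - k - j" n] by simp
  qed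
  finally show ?thesis using n by (simp add: sum_words_joint)
qed

lemma level_mean_ge:
  assumes "0 < n"
  shows "p * real d * level_mean (n - 1) + (if k \<le> n then q * real d ^ k * level_mean (n - k)
      - (\<Sum>m\<le>n - k. level_mean m * (p * q * real d ^ (n - k - m + k)
          * pair_weight p q k (int (n - k - m)) (int (n - k - m) + int k - 1))) else 0) \<le> level_mean n"
proof (cases "k \<le> n")
  case False
  have "level_mean n = (\<Sum>v\<in>words d n. p * joint v (n - 1) (n - 1))"
    using sum_words_joint[of n n] joint_diag_rec assms False by simp
  also have "\<dots> = p * real d * level_mean (n - 1)"
    using sum_words_joint[of "n - 1" n] assms by (simp add: sum_distrib_left[symmetric])
  finally show ?thesis using False by simp
next
  case True
  let ?h = "\<lambda>m. pair_weight p q k (int (n - k - m)) (int (n - k - m) + int k - 1)"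
  have "(\<Sum>v\<in>words d n. p * joint v (n - 1) (n - 1) + q * joint v (n - k) (n - k)
      - p * q * (\<Sum>m\<le>n - k. joint v m m * ?h m)) \<le> (\<Sum>v\<in>words d n. joint v n n)"
  proof (rule sum_mono)
    fix v assume v: "v \<in> words d n"
    have "joint v (n - k) (n - 1)
        \<le> (\<Sum>m\<le>n. joint v m m * pair_weight p q k (int (n - k) - int m) (int (n - 1) - int m))"
      by (rule joint_le_pair_weight) (use k p q joint_sym joint_nonneg joint_rec(1)[OF v] in auto)
    also have "\<dots> = (\<Sum>m\<le>n - k. joint v m m * ?h m)"
    proof (rule sum.mono_neutral_cong_right)
      show "\<forall>m\<in>{..n} - {..n - k}. joint v m m * pair_weight p q k (int (n - k) - int m) (int (n - 1) - int m) = 0"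
        by (auto simp: pair_weight_def)
      fix m assume "m \<in> {..n - k}"
      then have "int (n - k) - int m = int (n - k - m)" "int (n - 1) - int m = int (n - k - m) + int k - 1"
        using True k by auto
      then show "joint v m m * pair_weight p q k (int (n - k) - int m) (int (n - 1) - int m) = joint v m m * ?h m"
        by simp
    qed auto
    finally have "p * q * joint v (n - k) (n - 1) \<le> p * q * (\<Sum>m\<le>n - k. joint v m m * ?h m)"
      by (intro mult_left_mono) (use p q in auto)
    then show "p * joint v (n - 1) (n - 1) + q * joint v (n - k) (n - k)
      - p * q * (\<Sum>m\<le>n - k. joint v m m * ?h m) \<le> joint v n n"
      using joint_diag_rec[OF v assms] True by (simp only: if_True)
  qed
  moreover have "(\<Sum>v\<in>words d n. p * joint v (n - 1) (n - 1) + q * joint v (n - k) (n - k)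
      - p * q * (\<Sum>m\<le>n - k. joint v m m * ?h m))
    = p * (\<Sum>v\<in>words d n. joint v (n - 1) (n - 1)) + q * (\<Sum>v\<in>words d n. joint v (n - k) (n - k))
      - p * q * (\<Sum>m\<le>n - k. (\<Sum>v\<in>words d n. joint v m m) * ?h m)"
  proof -
    have "(\<Sum>v\<in>words d n. \<Sum>m\<le>n - k. joint v m m * ?h m) = (\<Sum>m\<le>n - k. (\<Sum>v\<in>words d n. joint v m m) * ?h m)"
      by (subst sum.swap) (simp add: sum_distrib_right)
    then show ?thesis by (simp only: sum.distrib sum_subtractf sum_distrib_left[symmetric])
  qed
  moreover have "p * q * (\<Sum>m\<le>n - k. (\<Sum>v\<in>words d n. joint v m m) * ?h m)
     = (\<Sum>m\<le>n - k. level_mean m * (p * q * real d ^ (n - k - m + k) * ?h m))"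
    unfolding sum_distrib_left
  proof (rule sum.cong[OF refl])
    fix m assume "m \<in> {..n - k}"
    then have "n - m = n - k - m + k" "m \<le> n" using True by auto
    then show "p * q * ((\<Sum>v\<in>words d n. joint v m m) * ?h m)
        = level_mean m * (p * q * real d ^ (n - k - m + k) * ?h m)"
      by (simp only: sum_words_joint) (simp only: mult_ac)
  qed
  ultimately show ?thesis using True assms sum_words_joint[of n n] sum_words_joint[of "n - 1" n]
      sum_words_joint[of "n - k" n] by simp
qed

end

section \<open>Finite and infinite clusters\<close>

context tree_percolation
begin

text \<open>
  The level means bound the probabilities that the levels are reached, so almost surely only
  finitely many levels are reached, and each level is finite.
\<close>

lemma prob_infinite_root_cluster_eq_0:
  assumes "\<And>N. (\<Sum>n\<le>N. level_mean n) \<le> B"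
  shows "prob {\<omega> \<in> space M. infinite (root_cluster d k \<omega>)} = 0"
proof -
  let ?U = "\<lambda>n. {\<omega> \<in> space M. \<exists>v\<in>words d n. open_path d k \<omega> [] v}"
  have U [measurable]: "?U n \<in> events" for n by measurable
  have le: "prob (?U n) \<le> level_mean n" for n
  proof -
    have "prob (?U n) = prob (\<Union>v\<in>words d n. {\<omega> \<in> space M. open_path d k \<omega> [] v})"
      by (rule arg_cong[where f = prob]) auto
    also have "\<dots> \<le> level_mean n"
      unfolding level_mean_def by (rule finite_measure_subadditive_finite) auto
    finally show ?thesis .
  qed
  have "summable level_mean"
    by (rule bounded_imp_summable[where B = B]) (use assms level_mean_nonneg in auto)
  then have "summable (\<lambda>n. prob (?U n))"
    by (rule summable_comparison_test'[where N = 0]) (use le in auto)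
  then have "AE \<omega> in M. eventually (\<lambda>n. \<omega> \<in> space M - ?U n) sequentially"
    by (intro borel_cantelli_AE1) (auto simp: less_top[symmetric])
  then have "AE \<omega> in M. \<not> infinite (root_cluster d k \<omega>)"
  proof (rule AE_mp, intro AE_I2 impI)
    fix \<omega> assume "\<omega> \<in> space M" "eventually (\<lambda>n. \<omega> \<in> space M - ?U n) sequentially"
    then obtain N where N: "\<And>n v. N \<le> n \<Longrightarrow> v \<in> words d n \<Longrightarrow> \<not> open_path d k \<omega> [] v"
      by (auto simp: eventually_sequentially)
    have "root_cluster d k \<omega> \<subseteq> (\<Union>n<N. words d n)"
    proof
      fix v assume "v \<in> root_cluster d k \<omega>"
      then have *: "open_path d k \<omega> [] v" by (simp add: root_cluster_def)
      then obtain w where "v = [] @ w" "set w \<subseteq> {1..d}" by (rule open_path_appendE)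
      then have "v \<in> words d (length v)" by (simp add: words_def)
      then show "v \<in> (\<Union>n<N. words d n)" using N[of "length v" v] * not_le by blast
    qed
    then have "finite (root_cluster d k \<omega>)" by (rule finite_subset) simp
    then show "\<not> infinite (root_cluster d k \<omega>)" by simp
  qed
  then show ?thesis
    using prob_eq_0[OF sets_infinite_root_cluster] by (simp add: AE_conj_iff)
qed

end

definition shift_edge :: "nat list \<Rightarrow> edge \<Rightarrow> edge" where
  "shift_edge u e = (u @ fst e, u @ snd e)"

lemma shift_edge_in_edges:
  assumes "set u \<subseteq> {1..d}" "e \<in> edges d k"
  shows "shift_edge u e \<in> edges d k"
    and "shift_edge u e \<in> short_edges d \<longleftrightarrow> e \<in> short_edges d"
proof -
  obtain x w where e: "e = (x, x @ w)" "set x \<subseteq> {1..d}" "set w \<subseteq> {1..d}" "length w = 1 \<or> length w = k"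
    using assms(2) by (cases e) (auto elim: edges_appendE)
  show "shift_edge u e \<in> edges d k"
    using append_in_edges_iff[of "u @ x" w d k] e assms(1) by (auto simp: shift_edge_def)
  show "shift_edge u e \<in> short_edges d \<longleftrightarrow> e \<in> short_edges d"
    using append_in_short_edges_iff[of "u @ x" w d] append_in_short_edges_iff[of x w d] e assms(1)
    by (auto simp: shift_edge_def)
qed

text \<open>
  Bonferroni's lower bound for a union of \<open>N\<close> independent events of probability \<open>\<tau>\<close>, with a
  generous quadratic term.
\<close>

lemma power_one_minus_le:
  fixes \<tau> :: real
  assumes "0 \<le> \<tau>" "\<tau> \<le> 1"
  shows "(1 - \<tau>) ^ N \<le> 1 - N * \<tau> + (N * \<tau>)\<^sup>2"
proof (induction N)
  case (Suc N)
  have "(1 - \<tau>) ^ Suc N \<le> (1 - \<tau>) * (1 - N * \<tau> + (N * \<tau>)\<^sup>2)"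
    using mult_left_mono[OF Suc, of "1 - \<tau>"] assms by simp
  also have "\<dots> = 1 - Suc N * \<tau> + (N + N\<^sup>2) * \<tau>\<^sup>2 - N\<^sup>2 * \<tau> ^ 3"
    by (simp add: algebra_simps power2_eq_square power3_eq_cube)
  also have "\<dots> \<le> 1 - Suc N * \<tau> + (N + N\<^sup>2) * \<tau>\<^sup>2"
    using assms by simp
  also have "\<dots> \<le> 1 - Suc N * \<tau> + (Suc N * \<tau>)\<^sup>2"
  proof -
    have "real (N + N\<^sup>2) \<le> (real (Suc N))\<^sup>2" by (simp add: power2_eq_square algebra_simps)
    then have "real (N + N\<^sup>2) * \<tau>\<^sup>2 \<le> (real (Suc N))\<^sup>2 * \<tau>\<^sup>2" by (rule mult_right_mono) simp
    then show ?thesis by (simp only: power_mult_distrib of_nat_add)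
  qed
  finally show ?case .
qed simp

context tree_percolation
begin

text \<open>
  The part of a configuration in the subtree of \<open>u\<close>, read as a configuration of the whole tree.
\<close>

definition subtree_config :: "nat list \<Rightarrow> (edge \<Rightarrow> bool) \<Rightarrow> edge \<Rightarrow> bool" where
  "subtree_config u \<omega> = (\<lambda>e\<in>edges d k. \<omega> (shift_edge u e))"

text \<open>
  Translation invariance: an edge and its shifted copy are open with the same probability.
\<close>

lemma distr_subtree_config:
  assumes "set u \<subseteq> {1..d}"
  shows "subtree_config u \<in> M \<rightarrow>\<^sub>M M" and "distr M M (subtree_config u) = M"
proof -
  let ?P = "\<lambda>e. measure_pmf (bernoulli_pmf (if e \<in> short_edges d then p else q))"
  have eq: "(\<Pi>\<^sub>M e\<in>edges d k. ?P (shift_edge u e)) = M"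
    unfolding percolation_def
    by (rule PiM_cong) (use shift_edge_in_edges[OF assms] in auto)
  have "inj_on (shift_edge u) (edges d k)" by (auto simp: inj_on_def shift_edge_def prod_eq_iff)
  moreover have "shift_edge u \<in> edges d k \<rightarrow> edges d k" using shift_edge_in_edges[OF assms] by auto
  ultimately have "distr (PiM (edges d k) ?P) (\<Pi>\<^sub>M e\<in>edges d k. ?P (shift_edge u e))
      (\<lambda>\<omega>. \<lambda>e\<in>edges d k. \<omega> (shift_edge u e)) = (\<Pi>\<^sub>M e\<in>edges d k. ?P (shift_edge u e))"
    by (intro distr_PiM_reindex measure_pmf.prob_space_axioms)
  then show "distr M M (subtree_config u) = M"
    unfolding eq by (simp add: percolation_def subtree_config_def[abs_def])
  have "(\<lambda>\<omega>. \<lambda>e\<in>edges d k. \<omega> (shift_edge u e)) \<in> M \<rightarrow>\<^sub>M (\<Pi>\<^sub>M e\<in>edges d k. ?P (shift_edge u e))"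
    unfolding percolation_def
    by (intro measurable_restrict measurable_component_singleton shift_edge_in_edges assms)
  then show "subtree_config u \<in> M \<rightarrow>\<^sub>M M"
    unfolding eq by (simp add: subtree_config_def[abs_def])
qed

lemma prob_subtree_config:
  assumes "set u \<subseteq> {1..d}" and [measurable]: "Measurable.pred M Y"
  shows "Measurable.pred M (\<lambda>\<omega>. Y (subtree_config u \<omega>))"
    and "prob {\<omega> \<in> space M. Y (subtree_config u \<omega>)} = prob {\<omega> \<in> space M. Y \<omega>}"
proof -
  note [measurable] = distr_subtree_config(1)[OF assms(1)]
  show "Measurable.pred M (\<lambda>\<omega>. Y (subtree_config u \<omega>))" by measurable
  have "prob {\<omega> \<in> space M. Y \<omega>} = measure (distr M M (subtree_config u)) {\<omega> \<in> space M. Y \<omega>}"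
    by (simp only: distr_subtree_config(2)[OF assms(1)])
  also have "\<dots> = prob (subtree_config u -` {\<omega> \<in> space M. Y \<omega>} \<inter> space M)"
    by (rule measure_distr) measurable
  also have "subtree_config u -` {\<omega> \<in> space M. Y \<omega>} \<inter> space M = {\<omega> \<in> space M. Y (subtree_config u \<omega>)}"
    using measurable_space[OF distr_subtree_config(1)[OF assms(1)]] by auto
  finally show "prob {\<omega> \<in> space M. Y (subtree_config u \<omega>)} = prob {\<omega> \<in> space M. Y \<omega>}" ..
qed

lemma depends_on_subtree_config:
  "depends_on (shift_edge u ` edges d k) (\<lambda>\<omega>. Y (subtree_config u \<omega>))"
proof (rule depends_onI)
  fix \<omega> \<omega>' assume "\<And>e. e \<in> shift_edge u ` edges d k \<Longrightarrow> \<omega> e = \<omega>' e" and Y: "Y (subtree_config u \<omega>)"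
  then have "subtree_config u \<omega> = subtree_config u \<omega>'"
    by (auto simp: subtree_config_def fun_eq_iff restrict_def)
  then show "Y (subtree_config u \<omega>')" using Y by simp
qed

lemma open_path_subtree_config:
  assumes "set u \<subseteq> {1..d}" "open_path d k (subtree_config u \<omega>) x y"
  shows "open_path d k \<omega> (u @ x) (u @ y)"
  using assms(2)
proof (induction rule: rtrancl_induct)
  case (step y z)
  then have "(u @ y, u @ z) \<in> {e \<in> edges d k. \<omega> e}"
    using shift_edge_in_edges(1)[OF assms(1), of "(y, z)"] by (auto simp: subtree_config_def shift_edge_def)
  with step.IH show ?case by (rule rtrancl.rtrancl_into_rtrancl)
qed simp

text \<open>
  The embedded branching process: the children of a vertex are its descendants \<open>n\<close> levels below that
  it reaches inside its own subtree, and the process lives for \<open>m\<close> generations.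
\<close>

primrec survives :: "nat \<Rightarrow> nat \<Rightarrow> (edge \<Rightarrow> bool) \<Rightarrow> bool" where
  "survives n 0 \<omega> \<longleftrightarrow> True"
| "survives n (Suc m) \<omega> \<longleftrightarrow> (\<exists>u\<in>words d n. open_path d k \<omega> [] u \<and> survives n m (subtree_config u \<omega>))"

lemma pred_survives [measurable]: "Measurable.pred M (survives n m)"
proof (induction m)
  case (Suc m)
  have "Measurable.pred M (\<lambda>\<omega>. survives n m (subtree_config u \<omega>))" if "u \<in> words d n" for u
    using prob_subtree_config(1)[OF _ Suc] that by (simp add: words_def)
  then have "Measurable.pred M (\<lambda>\<omega>. \<exists>u\<in>words d n. open_path d k \<omega> [] u \<and> survives n m (subtree_config u \<omega>))"
    by (intro pred_intros_finite pred_intros_logic pred_open_path) auto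
  then show ?case by (simp add: fun_eq_iff cong: measurable_cong)
qed simp

lemma survives_imp_open_path:
  "survives n m \<omega> \<Longrightarrow> \<exists>v. open_path d k \<omega> [] v \<and> length v = n * m"
proof (induction m arbitrary: \<omega>)
  case (Suc m)
  then obtain u where u: "u \<in> words d n" "open_path d k \<omega> [] u" "survives n m (subtree_config u \<omega>)"
    by auto
  from Suc.IH[OF u(3)] obtain v where v: "open_path d k (subtree_config u \<omega>) [] v" "length v = n * m"
    by blast
  have "open_path d k \<omega> ([] @ u) (u @ v)"
    using open_path_subtree_config[OF _ v(1)] u(1) by (simp add: words_def)
  with u v show ?case by (intro exI[of _ "u @ v"]) (auto simp: words_def)
qed auto

lemma pred_reached_set [measurable]:
  "Measurable.pred M (\<lambda>\<omega>. {u \<in> words d n. open_path d k \<omega> [] u} = B)"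
proof -
  have "Measurable.pred M (\<lambda>\<omega>. (\<forall>u\<in>words d n. open_path d k \<omega> [] u \<longleftrightarrow> u \<in> B) \<and> B \<subseteq> words d n)"
    by (intro pred_intros_finite pred_intros_logic pred_open_path) auto
  also have "(\<lambda>\<omega>. (\<forall>u\<in>words d n. open_path d k \<omega> [] u \<longleftrightarrow> u \<in> B) \<and> B \<subseteq> words d n)
      = (\<lambda>\<omega>. {u \<in> words d n. open_path d k \<omega> [] u} = B)" by (auto simp: fun_eq_iff)
  finally show ?thesis .
qed

text \<open>
  The generating function of the embedded process. Given the set \<open>B\<close> of children of the root, the
  processes started from them live in disjoint subtrees below level \<open>n\<close>, whereas \<open>B\<close> is determined by
  the edges above; all these events are independent.
\<close>

lemma prob_survives_Suc:
  assumes "0 < n"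
  defines "E \<equiv> \<lambda>B. {\<omega> \<in> space M. {u \<in> words d n. open_path d k \<omega> [] u} = B}"
  shows "1 - prob {\<omega> \<in> space M. survives n (Suc m) \<omega>}
    = (\<Sum>B\<in>Pow (words d n). prob (E B) * (1 - prob {\<omega> \<in> space M. survives n m \<omega>}) ^ card B)"
proof -
  let ?F = "\<lambda>B \<omega>. {u \<in> words d n. open_path d k \<omega> [] u} = B \<and> (\<forall>u\<in>B. \<not> survives n m (subtree_config u \<omega>))"
  have Fm: "Measurable.pred M (\<lambda>\<omega>. \<not> survives n m (subtree_config u \<omega>))" if "u \<in> words d n" for u
    using prob_subtree_config(1)[of u "survives n m"] that by (simp add: words_def)
  have "1 - prob {\<omega> \<in> space M. survives n (Suc m) \<omega>} = prob {\<omega> \<in> space M. \<not> survives n (Suc m) \<omega>}"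
    by (rule prob_neg[symmetric]) measurable
  also have "{\<omega> \<in> space M. \<not> survives n (Suc m) \<omega>} = (\<Union>B\<in>Pow (words d n). {\<omega> \<in> space M. ?F B \<omega>})"
    by auto
  also have "prob \<dots> = (\<Sum>B\<in>Pow (words d n). prob {\<omega> \<in> space M. ?F B \<omega>})"
  proof (rule finite_measure_finite_Union)
    show "(\<lambda>B. {\<omega> \<in> space M. ?F B \<omega>}) ` Pow (words d n) \<subseteq> events"
    proof safe
      fix B assume "B \<subseteq> words d n"
      then have "Measurable.pred M (?F B)"
        by (intro pred_intros_logic pred_reached_set pred_intros_finite Fm) (auto intro: finite_subset)
      then show "{\<omega> \<in> space M. ?F B \<omega>} \<in> events" by (simp add: pred_def)
    qed
  qed (auto simp: disjoint_family_on_def)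
  also have "\<dots> = (\<Sum>B\<in>Pow (words d n). prob (E B) * (1 - prob {\<omega> \<in> space M. survives n m \<omega>}) ^ card B)"
  proof (rule sum.cong[OF refl])
    fix B assume "B \<in> Pow (words d n)"
    then have B: "B \<subseteq> words d n" "finite B" by (auto intro: finite_subset)
    define K where "K j = (case j of None \<Rightarrow> {e \<in> edges d k. length (snd e) \<le> n}
        | Some u \<Rightarrow> shift_edge u ` edges d k)" for j
    define Y where "Y j \<omega> = (case j of None \<Rightarrow> {u \<in> words d n. open_path d k \<omega> [] u} = B
        | Some u \<Rightarrow> \<not> survives n m (subtree_config u \<omega>))" for j \<omega>
    let ?J = "insert None (Some ` B)"
    have Bw: "length u = n" "set u \<subseteq> {1..d}" if "u \<in> B" for u using that B by (auto simp: words_def)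
    have pos: "0 < length (snd e)" if "e \<in> edges d k" for e
      using that k by (cases e) (auto elim!: edges_appendE)
    have "prob {\<omega> \<in> space M. \<forall>j\<in>?J. Y j \<omega>} = (\<Prod>j\<in>?J. prob {\<omega> \<in> space M. Y j \<omega>})"
      unfolding percolation_def
    proof (rule prob_Ball_depends_on[where K = K], unfold percolation_def[symmetric])
      show "disjoint_family_on K ?J"
        unfolding disjoint_family_on_def K_def using Bw pos
        by (fastforce simp: shift_edge_def split: option.splits)
      fix j assume j: "j \<in> ?J"
      show "K j \<subseteq> edges d k"
        using j Bw shift_edge_in_edges(1) by (auto simp: K_def)
      show "Measurable.pred M (Y j)"
        unfolding Y_def using j B pred_reached_set Fm by (auto split: option.splits)
      show "depends_on (K j) (Y j)"
      proof (cases j)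
        case None
        show ?thesis
        proof (rule depends_onI)
          fix \<omega> \<omega>' assume eq: "\<And>e. e \<in> K j \<Longrightarrow> \<omega> e = \<omega>' e" and Y: "Y j \<omega>"
          have "open_path d k \<omega> [] u = open_path d k \<omega>' [] u" if "u \<in> words d n" for u
            by (rule depends_onD[OF depends_on_open_path])
              (rule eq, use that None in \<open>simp add: K_def words_def\<close>)
          then have "{u \<in> words d n. open_path d k \<omega> [] u} = {u \<in> words d n. open_path d k \<omega>' [] u}"
            by blast
          then show "Y j \<omega>'" using Y None by (simp only: Y_def option.case)
        qed
      next
        case (Some u)
        then show ?thesis using depends_on_subtree_config[of u "\<lambda>\<omega>. \<not> survives n m \<omega>"]
          by (simp add: K_def Y_def[abs_def])
      qed
    qed (use B in simp)
    moreover have "{\<omega> \<in> space M. ?F B \<omega>} = {\<omega> \<in> space M. \<forall>j\<in>?J. Y j \<omega>}"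
      by (auto simp: Y_def)
    moreover have "(\<Prod>j\<in>?J. prob {\<omega> \<in> space M. Y j \<omega>}) = prob (E B) * (\<Prod>u\<in>B. prob {\<omega> \<in> space M. Y (Some u) \<omega>})"
    proof -
      have "{\<omega> \<in> space M. Y None \<omega>} = E B" by (simp add: Y_def E_def)
      then show ?thesis using B by (subst prod.insert) (auto simp: prod.reindex)
    qed
    moreover have "prob {\<omega> \<in> space M. Y (Some u) \<omega>} = 1 - prob {\<omega> \<in> space M. survives n m \<omega>}"
      if "u \<in> B" for u
    proof -
      have "prob {\<omega> \<in> space M. Y (Some u) \<omega>} = prob {\<omega> \<in> space M. \<not> survives n m \<omega>}"
        unfolding Y_def option.case
        by (rule prob_subtree_config(2)[OF Bw(2)[OF that], of "\<lambda>\<omega>. \<not> survives n m \<omega>"]) measurable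
      also have "\<dots> = 1 - prob {\<omega> \<in> space M. survives n m \<omega>}" by (rule prob_neg) measurable
      finally show ?thesis .
    qed
    ultimately show "prob {\<omega> \<in> space M. ?F B \<omega>}
        = prob (E B) * (1 - prob {\<omega> \<in> space M. survives n m \<omega>}) ^ card B" by simp
  qed
  finally show ?thesis .
qed

text \<open>
  If \<open>\<tau>\<close> bounds the survival probability of \<open>m\<close> generations from below, then that of \<open>m + 1\<close>
  generations is at least \<open>\<tau> z - (K \<tau>)^2\<close>, where \<open>z > 1\<close> is the mean number of children and \<open>K\<close>
  their maximal number. The choice \<open>\<tau> = (z - 1) / K^2\<close> makes this equal to \<open>\<tau>\<close>.
\<close>

lemma prob_survives_ge:
  assumes n: "0 < n" and mean: "1 < level_mean n"
  shows "\<exists>\<tau>>0. \<forall>m. \<tau> \<le> prob {\<omega> \<in> space M. survives n m \<omega>}"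
proof -
  let ?W = "words d n"
  let ?R = "\<lambda>\<omega>. {u \<in> ?W. open_path d k \<omega> [] u}"
  define E where "E B = {\<omega> \<in> space M. ?R \<omega> = B}" for B
  define K where "K = real (card ?W)"
  define \<tau> where "\<tau> = (level_mean n - 1) / K\<^sup>2"
  have Em: "E B \<in> events" for B
    using pred_reached_set[of n B] by (simp add: pred_def E_def)
  have split: "(\<Sum>B\<in>Pow ?W. if P B then prob (E B) else 0) = prob {\<omega> \<in> space M. P (?R \<omega>)}" for P
  proof -
    have "(\<Sum>B\<in>Pow ?W. if P B then prob (E B) else 0) = (\<Sum>B\<in>{B \<in> Pow ?W. P B}. prob (E B))"
      by (rule sum.inter_filter[symmetric]) simp
    also have "\<dots> = prob (\<Union>B\<in>{B \<in> Pow ?W. P B}. E B)"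
      by (rule finite_measure_finite_Union[symmetric]) (use Em in \<open>auto simp: disjoint_family_on_def E_def\<close>)
    also have "(\<Union>B\<in>{B \<in> Pow ?W. P B}. E B) = {\<omega> \<in> space M. P (?R \<omega>)}" by (auto simp: E_def)
    finally show ?thesis .
  qed
  have total: "(\<Sum>B\<in>Pow ?W. prob (E B)) = 1" using split[of "\<lambda>_. True"] by (simp add: prob_space)
  have meanE: "(\<Sum>B\<in>Pow ?W. prob (E B) * card B) = level_mean n"
  proof -
    have "(\<Sum>B\<in>Pow ?W. prob (E B) * card B) = (\<Sum>B\<in>Pow ?W. \<Sum>u\<in>?W. if u \<in> B then prob (E B) else 0)"
    proof (rule sum.cong[OF refl])
      fix B assume "B \<in> Pow ?W"
      then have "{u \<in> ?W. u \<in> B} = B" by auto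
      then show "prob (E B) * card B = (\<Sum>u\<in>?W. if u \<in> B then prob (E B) else 0)"
        by (simp add: sum.inter_filter[symmetric])
    qed
    also have "\<dots> = (\<Sum>u\<in>?W. \<Sum>B\<in>Pow ?W. if u \<in> B then prob (E B) else 0)" by (rule sum.swap)
    also have "\<dots> = level_mean n" unfolding level_mean_def
      by (rule sum.cong[OF refl], subst split) (auto intro!: arg_cong[where f = prob])
    finally show ?thesis .
  qed
  have "(\<Sum>B\<in>Pow ?W. prob (E B) * card B) \<le> (\<Sum>B\<in>Pow ?W. prob (E B) * K)"
    by (intro sum_mono mult_left_mono) (auto simp: K_def card_mono)
  then have mK: "level_mean n \<le> K" using meanE total by (simp add: sum_distrib_right[symmetric])
  have K: "1 < K" using mK mean by simp
  have \<tau>: "0 < \<tau>" "\<tau> \<le> 1"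
    using mean K mK self_le_power[of K 2] by (auto simp: \<tau>_def field_simps)
  have "\<tau> \<le> prob {\<omega> \<in> space M. survives n m \<omega>}" for m
  proof (induction m)
    case (Suc m)
    have "1 - prob {\<omega> \<in> space M. survives n (Suc m) \<omega>}
        = (\<Sum>B\<in>Pow ?W. prob (E B) * (1 - prob {\<omega> \<in> space M. survives n m \<omega>}) ^ card B)"
      using prob_survives_Suc[OF n] by (simp add: E_def)
    also have "\<dots> \<le> (\<Sum>B\<in>Pow ?W. prob (E B) * (1 - \<tau> * card B + (K * \<tau>)\<^sup>2))"
    proof (intro sum_mono mult_left_mono)
      fix B assume "B \<in> Pow ?W"
      then have cB: "real (card B) \<le> K" by (simp add: K_def card_mono)
      have "(1 - prob {\<omega> \<in> space M. survives n m \<omega>}) ^ card B \<le> (1 - \<tau>) ^ card B"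
        using Suc by (intro power_mono) auto
      also have "\<dots> \<le> 1 - card B * \<tau> + (card B * \<tau>)\<^sup>2" by (rule power_one_minus_le) (use \<tau> in auto)
      also have "(card B * \<tau>)\<^sup>2 \<le> (K * \<tau>)\<^sup>2"
        by (intro power_mono mult_right_mono cB) (use \<tau> in auto)
      finally show "(1 - prob {\<omega> \<in> space M. survives n m \<omega>}) ^ card B \<le> 1 - \<tau> * card B + (K * \<tau>)\<^sup>2"
        by (simp add: mult.commute)
    qed simp
    also have "\<dots> = (\<Sum>B\<in>Pow ?W. (1 + (K * \<tau>)\<^sup>2) * prob (E B) - \<tau> * (prob (E B) * card B))"
      by (rule sum.cong[OF refl]) (simp add: algebra_simps)
    also have "\<dots> = (1 + (K * \<tau>)\<^sup>2) - \<tau> * level_mean n"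
      by (simp only: sum_subtractf sum_distrib_left[symmetric] total meanE mult_1_right)
    also have "(K * \<tau>)\<^sup>2 = \<tau> * (level_mean n - 1)"
      using K by (simp add: \<tau>_def power2_eq_square)
    finally show ?case by (simp add: algebra_simps)
  qed (use \<tau> in \<open>simp add: prob_space\<close>)
  then show ?thesis using \<tau> by blast
qed

lemma prob_infinite_root_cluster_pos:
  assumes n: "0 < n" and mean: "1 < level_mean n"
  shows "0 < prob {\<omega> \<in> space M. infinite (root_cluster d k \<omega>)}"
proof -
  obtain \<tau> where \<tau>: "0 < \<tau>" "\<And>m. \<tau> \<le> prob {\<omega> \<in> space M. survives n m \<omega>}"
    using prob_survives_ge[OF assms] by blast
  define D where "D m = {\<omega> \<in> space M. \<exists>v. open_path d k \<omega> [] v \<and> m \<le> length v}" for m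
  have Dm: "D m \<in> events" for m
  proof -
    have "Measurable.pred M (\<lambda>\<omega>. \<exists>v. open_path d k \<omega> [] v \<and> m \<le> length v)"
      by (intro pred_intros_countable pred_intros_logic pred_open_path) simp
    then show ?thesis by (simp add: pred_def D_def)
  qed
  have D: "\<tau> \<le> prob (D m)" for m
  proof -
    have "{\<omega> \<in> space M. survives n m \<omega>} \<subseteq> D m"
    proof
      fix \<omega> assume *: "\<omega> \<in> {\<omega> \<in> space M. survives n m \<omega>}"
      then obtain v where "open_path d k \<omega> [] v" "length v = n * m"
        using survives_imp_open_path by blast
      then show "\<omega> \<in> D m" using * n by (auto simp: D_def)
    qed
    then show ?thesis using \<tau>(2)[of m] finite_measure_mono[OF _ Dm] order_trans by blast
  qed
  have "decseq D" by (auto simp: decseq_def D_def intro: order_trans)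
  then have "(\<lambda>m. prob (D m)) \<longlonglongrightarrow> prob (\<Inter>m. D m)"
    by (intro finite_Lim_measure_decseq) (use Dm in auto)
  then have "\<tau> \<le> prob (\<Inter>m. D m)" by (rule LIMSEQ_le_const) (use D in auto)
  also have "\<dots> \<le> prob {\<omega> \<in> space M. infinite (root_cluster d k \<omega>)}"
  proof (rule finite_measure_mono[OF _ sets_infinite_root_cluster], safe)
    fix \<omega> assume \<omega>: "\<omega> \<in> (\<Inter>m. D m)"
    then show "\<omega> \<in> space M" by (auto simp: D_def)
    assume "finite (root_cluster d k \<omega>)"
    then have "finite (length ` root_cluster d k \<omega>)" by simp
    then obtain N where N: "\<And>v. v \<in> root_cluster d k \<omega> \<Longrightarrow> length v \<le> N"
      by (auto simp: finite_nat_set_iff_bounded_le)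
    from \<omega> obtain v where "open_path d k \<omega> [] v" "Suc N \<le> length v" by (auto simp: D_def)
    then show False using N[of v] by (simp add: root_cluster_def)
  qed
  finally show ?thesis using \<tau> by simp
qed

end

section \<open>Expansion of the critical value\<close>

text \<open>
  The total loss caused by double entries. Below level \<open>k\<close> a path weight is a power of \<open>p\<close>, and the
  diagonal terms form the geometric series of \<open>p^2 D\<close>. All remaining terms contain path weights of
  length at least \<open>k - 1\<close>; they are bounded by \<open>1 / s^n\<close>, and since \<open>s^2 > D\<close> they sum to a
  geometric tail. The term \<open>p^k\<close> comes from a splitting at level \<open>n - k\<close> itself.
\<close>

lemma sum_pair_weight_le:
  fixes D :: real
  assumes k: "2 \<le> k" and p: "0 \<le> p" "p \<le> 1" and q: "0 \<le> q" and D: "1 \<le> D" "p\<^sup>2 * D < 1"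
    and s: "0 < s" "D < s\<^sup>2" "p * s + q * s ^ k \<le> 1"
  defines "r \<equiv> D / s\<^sup>2"
  shows "(\<Sum>x\<le>N. p * q * D ^ (x + k) * pair_weight p q k (int x) (int x + int k - 1))
    \<le> q * D ^ k * (p ^ k + q * (p\<^sup>2 * D / (1 - p\<^sup>2 * D) + 2 * D * r ^ (k - 1) / (1 - r)))"
proof -
  let ?b = "path_weight p q k"
  let ?g = "\<lambda>x. p * q * D ^ (x + k) * pair_weight p q k (int x) (int x + int k - 1)"
  have r: "0 < r" "r < 1" using s D by (auto simp: r_def field_simps)
  have bn: "0 \<le> ?b n" for n by (rule path_weight_nonneg) (use p q in auto)
  have bs: "?b n \<le> 1 / s ^ n" for n by (rule path_weight_le) (use p q s in auto)
  have p2: "p\<^sup>2 \<le> 1" using p by (simp add: power_le_one)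
  have prod_le: "D ^ Suc x * (p\<^sup>2 * (?b m * ?b n)) \<le> D * r ^ x" if "m + n = 2 * x" for x m n
  proof -
    have "?b m * ?b n \<le> (1 / s ^ m) * (1 / s ^ n)" by (intro mult_mono bs bn) (use s in auto)
    also have "\<dots> = 1 / (s\<^sup>2) ^ x"
      by (simp add: power_add[symmetric] that power_mult[symmetric])
    finally have "p\<^sup>2 * (?b m * ?b n) \<le> 1 * (1 / (s\<^sup>2) ^ x)"
      using p2 bn by (intro mult_mono) auto
    then have "D ^ Suc x * (p\<^sup>2 * (?b m * ?b n)) \<le> D ^ Suc x * (1 / (s\<^sup>2) ^ x)"
      using D by (intro mult_left_mono) auto
    then show ?thesis by (simp add: r_def power_divide)
  qed
  let ?I = "\<lambda>x. if k - 1 \<le> x then r ^ x else 0"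
  have g0: "?g 0 = q * D ^ k * p ^ k"
  proof -
    have "pair_weight p q k 0 (int k - 1) = p ^ (k - 1)"
      using k by (simp add: pair_weight_def zpath_weight_def nat_diff_distrib path_weight_below)
    then show ?thesis using k by (cases k) auto
  qed
  have gSuc: "?g (Suc x) \<le> q * D ^ k * q * (p\<^sup>2 * D * (p\<^sup>2 * D) ^ x + 2 * D * ?I x)" for x
  proof -
    let ?c = "if k - 1 \<le> x then ?b (x + 1 - k) * ?b (x + k - 1) else 0"
    have "zpath_weight p q k (int (Suc x) - int k) = (if k - 1 \<le> x then ?b (x + 1 - k) else 0)"
      using k by (auto simp: zpath_weight_def nat_diff_distrib Suc_diff_le intro!: arg_cong[where f = ?b])
    moreover have "zpath_weight p q k (int (Suc x) + int k - 1 - 1) = ?b (x + k - 1)"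
      using k by (auto simp: zpath_weight_def intro!: arg_cong[where f = ?b])
    moreover have "zpath_weight p q k (int (Suc x) - 1) = ?b x"
      "zpath_weight p q k (int (Suc x) + int k - 1 - int k) = ?b x"
      by (simp_all add: zpath_weight_def)
    ultimately have h: "pair_weight p q k (int (Suc x)) (int (Suc x) + int k - 1) = p * q * (?b x * ?b x + ?c)"
      using k by (simp add: pair_weight_def Let_def)
    have "D ^ Suc x * (p\<^sup>2 * (?b x * ?b x)) \<le> p\<^sup>2 * D * (p\<^sup>2 * D) ^ x + D * ?I x"
    proof (cases "x < k")
      case True
      then have "D ^ Suc x * (p\<^sup>2 * (?b x * ?b x)) = p\<^sup>2 * D * (p\<^sup>2 * D) ^ x"
        by (simp add: path_weight_below power_mult_distrib power2_eq_square)
      moreover have "0 \<le> D * ?I x" using D r by simp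
      ultimately show ?thesis by linarith
    next
      case False
      moreover have "0 \<le> p\<^sup>2 * D * (p\<^sup>2 * D) ^ x" using D by simp
      moreover have "k - 1 \<le> x" using False by simp
      ultimately show ?thesis using prod_le[of x x x] by simp
    qed
    moreover have "D ^ Suc x * (p\<^sup>2 * ?c) \<le> D * ?I x"
      using prod_le[of "x + 1 - k" "x + k - 1" x] k by auto
    ultimately have "D ^ Suc x * (p\<^sup>2 * (?b x * ?b x + ?c)) \<le> p\<^sup>2 * D * (p\<^sup>2 * D) ^ x + 2 * D * ?I x"
      by (simp only: distrib_left)
    from mult_left_mono[OF this, of "q * D ^ k * q"]
    show ?thesis unfolding h using q D by (simp add: power_add power2_eq_square mult_ac)
  qed
  have geo: "(\<Sum>x<N. (p\<^sup>2 * D) ^ x) \<le> 1 / (1 - p\<^sup>2 * D)"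
    using sum_gp_strict[of "p\<^sup>2 * D" N] D p by (simp add: divide_right_mono)
  have geo_tail: "(\<Sum>x<N. ?I x) \<le> r ^ (k - 1) / (1 - r)"
  proof -
    have "(\<Sum>x<N. ?I x) \<le> (\<Sum>x<k - 1 + N. ?I x)" by (rule sum_mono2) (use r in auto)
    also have "\<dots> = (\<Sum>x=k - 1..<k - 1 + N. r ^ x)" by (rule sum.mono_neutral_cong_right) auto
    also have "\<dots> = (\<Sum>x<N. r ^ (k - 1) * r ^ x)"
      by (rule sum.reindex_bij_witness[of _ "\<lambda>x. x + (k - 1)" "\<lambda>x. x - (k - 1)"])
        (auto simp: power_add[symmetric])
    also have "\<dots> = r ^ (k - 1) * ((1 - r ^ N) / (1 - r))"
      using r by (simp add: sum_distrib_left[symmetric] sum_gp_strict)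
    also have "\<dots> \<le> r ^ (k - 1) * (1 / (1 - r))"
      using r by (intro mult_left_mono divide_right_mono) auto
    finally show ?thesis by simp
  qed
  have "(\<Sum>x\<le>N. ?g x) = ?g 0 + (\<Sum>x<N. ?g (Suc x))"
    by (rule sum.atMost_shift)
  also have "(\<Sum>x<N. ?g (Suc x)) \<le> (\<Sum>x<N. q * D ^ k * q * (p\<^sup>2 * D * (p\<^sup>2 * D) ^ x + 2 * D * ?I x))"
    by (intro sum_mono gSuc)
  also have "\<dots> = q * D ^ k * q * (p\<^sup>2 * D * (\<Sum>x<N. (p\<^sup>2 * D) ^ x) + 2 * D * (\<Sum>x<N. ?I x))"
    by (simp only: sum_distrib_left[symmetric] sum.distrib)
  also have "\<dots> \<le> q * D ^ k * q * (p\<^sup>2 * D * (1 / (1 - p\<^sup>2 * D)) + 2 * D * (r ^ (k - 1) / (1 - r)))"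
    by (intro mult_left_mono add_mono geo geo_tail) (use q D p in auto)
  also have "?g 0 + \<dots> = q * D ^ k * (p ^ k + q * (p\<^sup>2 * D / (1 - p\<^sup>2 * D) + 2 * D * r ^ (k - 1) / (1 - r)))"
    by (simp only: g0) (simp add: algebra_simps)
  finally show ?thesis by simp
qed

lemma square_mult_less_one:
  fixes p D :: real
  assumes "0 \<le> p" "p \<le> 1" "p * D < 1" "0 \<le> D"
  shows "p\<^sup>2 * D < 1"
proof -
  have "p * (p * D) \<le> 1 * (p * D)" using assms by (intro mult_right_mono) auto
  then show ?thesis using assms by (simp add: power2_eq_square mult.assoc)
qed

lemma LIMSEQ_divide_power_zero:
  fixes c D :: real
  assumes "1 < D"
  shows "(\<lambda>k. c / D ^ k) \<longlonglongrightarrow> 0"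
  using tendsto_mult[OF tendsto_const[of c] LIMSEQ_inverse_realpow_zero[OF assms]]
  by (simp add: field_simps)

text \<open>
  If \<open>q d^k < 1 - p d\<close>, the union bound suffices. Otherwise \<open>x = q d^k - (1 - p d)\<close> lies between \<open>0\<close>
  and \<open>y / d^k\<close>, and the loops with \<open>j \<le> J\<close> have to compensate for \<open>x\<close>. Their total weight is at least
  \<open>(1 - p d)^2 / d^k\<close> times a partial sum of the geometric series, up to factors that tend to
  one, and \<open>J\<close> is chosen so that this partial sum is large enough for \<open>y\<close>.
\<close>

lemma eventually_subcritical:
  fixes d :: nat and p y :: real
  assumes d: "2 \<le> d" and pd: "p \<in> {0..1}" "p * real d < 1"
    and y: "y < (1 - p * real d)\<^sup>2 * (p\<^sup>2 * real d / (1 - p\<^sup>2 * real d))"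
  shows "eventually (\<lambda>k. \<forall>q\<in>{0..1}. q * real d ^ k < (1 - p * real d) + y / real d ^ k \<longrightarrow>
    measure (percolation d k p q) {\<omega> \<in> space (percolation d k p q). infinite (root_cluster d k \<omega>)} = 0) at_top"
proof -
  define \<alpha> where "\<alpha> = 1 - p * real d"
  define \<rho> where "\<rho> = p\<^sup>2 * real d"
  have \<alpha>: "0 < \<alpha>" using pd by (simp add: \<alpha>_def)
  have \<rho>: "0 \<le> \<rho>" "\<rho> < 1" using square_mult_less_one[of p "real d"] pd by (auto simp: \<rho>_def)
  have "(\<lambda>J. \<alpha>\<^sup>2 * (\<Sum>j=1..J. \<rho> ^ j)) \<longlonglongrightarrow> \<alpha>\<^sup>2 * (\<rho> / (1 - \<rho>))"
  proof -
    have "(\<lambda>J. \<Sum>j<J. \<rho> ^ j) \<longlonglongrightarrow> 1 / (1 - \<rho>)"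
      using geometric_sums[of \<rho>] \<rho> by (simp add: sums_def)
    then have "(\<lambda>J. \<alpha>\<^sup>2 * (\<rho> * (\<Sum>j<J. \<rho> ^ j))) \<longlonglongrightarrow> \<alpha>\<^sup>2 * (\<rho> * (1 / (1 - \<rho>)))"
      by (intro tendsto_intros)
    moreover have "\<rho> * (\<Sum>j<J. \<rho> ^ j) = (\<Sum>j=1..J. \<rho> ^ j)" for J
      by (simp add: sum.atLeast1_atMost_eq sum_distrib_left)
    ultimately show ?thesis by simp
  qed
  then have "eventually (\<lambda>J. y < \<alpha>\<^sup>2 * (\<Sum>j=1..J. \<rho> ^ j)) at_top"
    by (rule order_tendstoD) (use y in \<open>simp add: \<alpha>_def \<rho>_def\<close>)
  then obtain J where J: "y < \<alpha>\<^sup>2 * (\<Sum>j=1..J. \<rho> ^ j)"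
    by (auto simp: eventually_sequentially)
  define X where "X k = y / real d ^ k" for k
  define Q where "Q k = (\<alpha> + X k) / real d ^ k" for k
  have inv: "(\<lambda>k. c / real d ^ k) \<longlonglongrightarrow> 0" for c
    by (rule LIMSEQ_divide_power_zero) (use d in simp)
  have X: "X \<longlonglongrightarrow> 0" unfolding X_def by (rule inv)
  have "(\<lambda>k. (\<alpha> + X k) * (1 / real d ^ k)) \<longlonglongrightarrow> (\<alpha> + 0) * 0"
    by (intro tendsto_mult tendsto_add tendsto_const X inv)
  then have Q: "Q \<longlonglongrightarrow> 0" by (simp add: Q_def[abs_def])
  have "(\<lambda>k. \<alpha>\<^sup>2 * ((1 - Q k) ^ (2 * J) / (1 + X k) ^ J * (\<Sum>j=1..J. \<rho> ^ j)))
      \<longlonglongrightarrow> \<alpha>\<^sup>2 * ((1 - 0) ^ (2 * J) / (1 + 0) ^ J * (\<Sum>j=1..J. \<rho> ^ j))"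
    by (intro tendsto_intros X Q) auto
  then have ev: "eventually (\<lambda>k. y < \<alpha>\<^sup>2 * ((1 - Q k) ^ (2 * J) / (1 + X k) ^ J * (\<Sum>j=1..J. \<rho> ^ j))) at_top"
    by (rule order_tendstoD) (use J in simp)
  have "eventually (\<lambda>k. Q k < 1) at_top" using order_tendstoD(2)[OF Q] by simp
  from ev this eventually_ge_at_top[of "J + 2"] show ?thesis
  proof eventually_elim
    case (elim k)
    have dk: "0 < real d ^ k" using d by simp
    show ?case
    proof (intro ballI impI)
      fix q :: real assume q: "q \<in> {0..1}" and lt: "q * real d ^ k < (1 - p * real d) + y / real d ^ k"
      interpret tree_percolation d k p q
        by unfold_locales (use elim pd q in auto)
      have "\<exists>B. \<forall>N. (\<Sum>n\<le>N. level_mean n) \<le> B"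
      proof (cases "q * real d ^ k < \<alpha>")
        case True
        show ?thesis
        proof (rule partial_sums_bounded_if_subcritical[where P = "p * real d" and Q = "q * real d ^ k" and x = 0
              and J = 0 and w = "\<lambda>_. 0" and k = k])
          fix n assume "k + 0 \<le> n"
          then show "level_mean n \<le> p * real d * level_mean (n - 1) + q * real d ^ k * level_mean (n - k)
              - (\<Sum>j=1..0. 0 * level_mean (n - k - j))"
            using level_mean_le[of n] k by simp
        qed (use level_mean_0 level_mean_nonneg level_mean_le pd q k True in \<open>auto simp: \<alpha>_def\<close>)
      next
        case False
        define x where "x = q * real d ^ k - \<alpha>"
        have x: "0 \<le> x" "x < X k" using False lt by (auto simp: x_def X_def \<alpha>_def)
        have qQ: "q \<le> Q k" using x dk by (simp add: Q_def x_def field_simps)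
        define w where "w j = p * q * (p * (1 - q)) ^ (2 * j - 1) * q * real d ^ (k + j)" for j
        have w_ge: "(\<alpha>\<^sup>2 / real d ^ k) * ((1 - Q k) ^ (2 * J) / (1 + X k) ^ J * \<rho> ^ j) \<le> w j / (1 + x) ^ j"
          if j: "j \<in> {1..J}" for j
        proof -
          have "\<alpha>\<^sup>2 / real d ^ k \<le> (q * real d ^ k)\<^sup>2 / real d ^ k"
            using False \<alpha> by (intro divide_right_mono power_mono) auto
          also have "\<dots> = q\<^sup>2 * real d ^ k" using dk by (simp add: power2_eq_square)
          finally have 1: "\<alpha>\<^sup>2 / real d ^ k \<le> q\<^sup>2 * real d ^ k" .
          have "(1 - Q k) ^ (2 * J) \<le> (1 - q) ^ (2 * J)"
            using qQ elim by (intro power_mono) auto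
          also have "\<dots> \<le> (1 - q) ^ (2 * j - 1)"
            using j q by (intro power_decreasing) auto
          finally have 2: "(1 - Q k) ^ (2 * J) \<le> (1 - q) ^ (2 * j - 1)" .
          have "(1 + x) ^ j \<le> (1 + x) ^ J" using x j by (intro power_increasing) auto
          also have "\<dots> \<le> (1 + X k) ^ J" using x by (intro power_mono) auto
          finally have 3: "(1 + x) ^ j \<le> (1 + X k) ^ J" .
          have "(1 - Q k) ^ (2 * J) / (1 + X k) ^ J \<le> (1 - q) ^ (2 * j - 1) / (1 + x) ^ j"
            by (rule frac_le) (use 2 3 q x in auto)
          then have "(\<alpha>\<^sup>2 / real d ^ k) * ((1 - Q k) ^ (2 * J) / (1 + X k) ^ J * \<rho> ^ j)
              \<le> (q\<^sup>2 * real d ^ k) * ((1 - q) ^ (2 * j - 1) / (1 + x) ^ j * \<rho> ^ j)"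
            using 1 \<rho> x by (intro mult_mono mult_right_mono) auto
          also have "\<dots> = w j / (1 + x) ^ j"
          proof -
            have "\<rho> ^ j = p * p ^ (2 * j - 1) * real d ^ j"
              using j by (simp add: \<rho>_def power_mult_distrib power_mult[symmetric] power_Suc[symmetric]
                  del: power_Suc)
            then show ?thesis
              by (simp add: w_def power_mult_distrib power_add power2_eq_square mult_ac)
          qed
          finally show ?thesis .
        qed
        have "x < X k" by (rule x)
        also have "X k \<le> (\<alpha>\<^sup>2 * ((1 - Q k) ^ (2 * J) / (1 + X k) ^ J * (\<Sum>j=1..J. \<rho> ^ j))) / real d ^ k"
          unfolding X_def using elim(1) dk by (intro divide_right_mono) (auto simp: X_def)
        also have "\<dots> = (\<Sum>j=1..J. (\<alpha>\<^sup>2 / real d ^ k) * ((1 - Q k) ^ (2 * J) / (1 + X k) ^ J * \<rho> ^ j))"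
          by (simp only: sum_distrib_left[symmetric]) simp
        also have "\<dots> \<le> (\<Sum>j=1..J. w j / (1 + x) ^ j)" by (intro sum_mono w_ge)
        finally have sub: "x < (\<Sum>j=1..J. w j / (1 + x) ^ j)" .
        show ?thesis
        proof (rule partial_sums_bounded_if_subcritical[where P = "p * real d" and Q = "q * real d ^ k" and x = x
              and J = J and w = w and k = k])
          fix n assume "k + J \<le> n"
          then show "level_mean n \<le> p * real d * level_mean (n - 1) + q * real d ^ k * level_mean (n - k)
              - (\<Sum>j=1..J. w j * level_mean (n - k - j))"
            using level_mean_le_loops[of J n] elim by (simp add: w_def)
        qed (use level_mean_0 level_mean_nonneg level_mean_le pd q k x sub in \<open>auto simp: \<alpha>_def x_def w_def\<close>)
      qed
      then show "prob {\<omega> \<in> space M. infinite (root_cluster d k \<omega>)} = 0"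
        using prob_infinite_root_cluster_eq_0 by blast
    qed
  qed
qed

text \<open>
  The growth rate of path weights is controlled with \<open>s = 3 d / 4\<close>: then \<open>p s < 1\<close> and \<open>q s^k\<close> tends
  to zero, whereas \<open>s^2 > d\<close> because of \<open>d \<ge> 2\<close>.
\<close>

lemma eventually_supercritical:
  fixes d :: nat and p y :: real
  assumes d: "2 \<le> d" and pd: "p \<in> {0..1}" "p * real d < 1"
    and y: "(1 - p * real d)\<^sup>2 * (p\<^sup>2 * real d / (1 - p\<^sup>2 * real d)) < y"
  defines "q \<equiv> \<lambda>k. ((1 - p * real d) + y / real d ^ k) / real d ^ k"
  shows "eventually (\<lambda>k. q k \<in> {0..1} \<and> 0 < measure (percolation d k p (q k))
    {\<omega> \<in> space (percolation d k p (q k)). infinite (root_cluster d k \<omega>)}) at_top"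
proof -
  define \<alpha> where "\<alpha> = 1 - p * real d"
  define \<rho> where "\<rho> = p\<^sup>2 * real d"
  have \<alpha>: "0 < \<alpha>" using pd by (simp add: \<alpha>_def)
  have \<rho>: "0 \<le> \<rho>" "\<rho> < 1" using square_mult_less_one[of p "real d"] pd by (auto simp: \<rho>_def)
  have "0 \<le> \<alpha>\<^sup>2 * (\<rho> / (1 - \<rho>))" using \<rho> by simp
  then have y0: "0 < y" using y by (simp add: \<alpha>_def \<rho>_def)
  define s where "s = 3 / 4 * real d"
  define r where "r = real d / s\<^sup>2"
  define Q where "Q k = \<alpha> + y / real d ^ k" for k
  \<comment> \<open>the loss of mass, multiplied by \<open>d^k\<close> and divided by \<open>q d^k\<close>\<close>
  define E where "E k = p ^ k * real d ^ k + Q k * (\<rho> / (1 - \<rho>) + 2 * real d * r ^ (k - 1) / (1 - r))" for k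
  have r: "0 < r" "r < 1" using d by (auto simp: r_def s_def power2_eq_square field_simps)
  have s: "0 < s" "real d < s\<^sup>2" using d r by (auto simp: s_def r_def field_simps split: if_splits)
  have inv: "(\<lambda>k. c / real d ^ k) \<longlonglongrightarrow> 0" for c
    by (rule LIMSEQ_divide_power_zero) (use d in simp)
  have "Q \<longlonglongrightarrow> \<alpha> + 0" unfolding Q_def by (intro tendsto_intros inv)
  then have Q: "Q \<longlonglongrightarrow> \<alpha>" by simp
  have "(\<lambda>k. Q k * (1 / real d ^ k)) \<longlonglongrightarrow> \<alpha> * 0" by (intro tendsto_mult Q inv)
  moreover have q_eq: "q = (\<lambda>k. Q k / real d ^ k)" by (simp add: q_def Q_def \<alpha>_def)
  ultimately have q0: "q \<longlonglongrightarrow> 0" by simp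
  have "(\<lambda>k. p * s + Q k * (3 / 4) ^ k) \<longlonglongrightarrow> p * s + \<alpha> * 0"
    by (intro tendsto_intros Q LIMSEQ_realpow_zero) auto
  then have ev_s: "eventually (\<lambda>k. p * s + Q k * (3 / 4) ^ k < 1) at_top"
    by (rule order_tendstoD) (use pd in \<open>simp add: s_def\<close>)
  have "(\<lambda>k. (p * real d) ^ k + Q k * (\<rho> / (1 - \<rho>) + 2 * real d * r ^ (k - 1) / (1 - r)))
      \<longlonglongrightarrow> 0 + \<alpha> * (\<rho> / (1 - \<rho>) + 2 * real d * 0 / (1 - r))"
  proof (intro tendsto_intros Q LIMSEQ_realpow_zero)
    show "(\<lambda>k. r ^ (k - 1)) \<longlonglongrightarrow> 0"
      by (rule LIMSEQ_offset[where k = 1]) (use r in \<open>simp add: LIMSEQ_realpow_zero\<close>)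
  qed (use pd r \<rho> in auto)
  then have "E \<longlonglongrightarrow> \<alpha> * (\<rho> / (1 - \<rho>))" by (simp add: E_def[abs_def] power_mult_distrib)
  from tendsto_mult[OF Q this] have "(\<lambda>k. Q k * E k) \<longlonglongrightarrow> \<alpha>\<^sup>2 * (\<rho> / (1 - \<rho>))"
    by (simp add: power2_eq_square mult.assoc)
  then have ev_E: "eventually (\<lambda>k. Q k * E k < y) at_top"
    by (rule order_tendstoD) (use y in \<open>simp add: \<alpha>_def \<rho>_def\<close>)
  have ev_q: "eventually (\<lambda>k. q k < 1) at_top" using order_tendstoD(2)[OF q0] by simp
  from ev_s ev_E ev_q eventually_ge_at_top[of 2] show ?thesis
  proof eventually_elim
    case (elim k)
    have dk: "0 < real d ^ k" using d by simp
    have Qp: "0 < Q k" using \<alpha> y0 dk by (simp add: Q_def add_pos_pos)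
    have qp: "0 < q k" using Qp dk by (simp add: q_eq)
    have qQ: "q k * real d ^ k = Q k" using dk by (simp add: q_eq)
    interpret tree_percolation d k p "q k"
      by unfold_locales (use elim pd qp in auto)
    let ?g = "\<lambda>x. p * q k * real d ^ (x + k) * pair_weight p (q k) k (int x) (int x + int k - 1)"
    define G where "G = q k * real d ^ k * (p ^ k + q k * (p\<^sup>2 * real d / (1 - p\<^sup>2 * real d)
        + 2 * real d * (real d / s\<^sup>2) ^ (k - 1) / (1 - real d / s\<^sup>2)))"
    have "s ^ k = (3 / 4) ^ k * real d ^ k" unfolding s_def by (rule power_mult_distrib)
    then have "q k * s ^ k = Q k * (3 / 4) ^ k" by (simp only: qQ[symmetric] mult_ac)
    then have ps: "p * s + q k * s ^ k \<le> 1" using elim by simp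
    have gG: "(\<Sum>x\<le>N. ?g x) \<le> G" for N
      unfolding G_def by (rule sum_pair_weight_le) (use k pd qp d \<rho> s ps in \<open>auto simp: \<rho>_def\<close>)
    have "G = Q k * E k / real d ^ k"
      unfolding G_def qQ using dk by (simp add: q_eq E_def r_def \<rho>_def field_simps)
    also have "\<dots> < y / real d ^ k" using elim dk by (intro divide_strict_right_mono)
    finally have super: "1 < p * real d + Q k - G" by (simp add: Q_def \<alpha>_def)
    have "\<exists>n>0. 1 < level_mean n"
    proof (rule exceeds_one_if_supercritical[where P = "p * real d" and Q = "Q k" and k = k and g = ?g and G = G])
      fix n :: nat assume "0 < n"
      then show "p * real d * level_mean (n - 1) + (if k \<le> n then Q k * level_mean (n - k)
          - (\<Sum>m\<le>n - k. level_mean m * ?g (n - k - m)) else 0) \<le> level_mean n"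
        using level_mean_ge[of n] by (simp only: qQ)
    next
      fix n show "0 \<le> ?g n"
        using pd qp by (intro mult_nonneg_nonneg pair_weight_nonneg) auto
    qed (use level_mean_0 level_mean_nonneg pd k gG super in auto)
    then show ?case using prob_infinite_root_cluster_pos elim qp by auto
  qed
qed

theorem theorem1p2:
  fixes d :: nat and p :: real
  assumes "d \<ge> 2" and "p \<in> {0..1}" and "p * real d < 1"
  shows "(\<lambda>k. critical_value d k p
            - ((1 - p * real d) * (1 / real d ^ k)
               + (1 - p * real d)\<^sup>2 * p\<^sup>2 * real d / (1 - p\<^sup>2 * real d) * (1 / real d ^ (2 * k))))
         \<in> o[at_top](\<lambda>k. 1 / real d ^ (2 * k))"
proof (rule landau_o.smallI)
  fix c :: real assume c: "0 < c"
  define a where "a = 1 - p * real d"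
  define b where "b = (1 - p * real d)\<^sup>2 * (p\<^sup>2 * real d / (1 - p\<^sup>2 * real d))"
  have "eventually (\<lambda>k. \<forall>q\<in>{0..1}. q * real d ^ k < a + (b - c) / real d ^ k \<longrightarrow>
    measure (percolation d k p q) {\<omega> \<in> space (percolation d k p q). infinite (root_cluster d k \<omega>)} = 0) at_top"
    unfolding a_def by (rule eventually_subcritical) (use assms c in \<open>auto simp: b_def\<close>)
  moreover have "eventually (\<lambda>k. (a + (b + c) / real d ^ k) / real d ^ k \<in> {0..1}
    \<and> 0 < measure (percolation d k p ((a + (b + c) / real d ^ k) / real d ^ k))
     {\<omega> \<in> space (percolation d k p ((a + (b + c) / real d ^ k) / real d ^ k)). infinite (root_cluster d k \<omega>)}) at_top"
    unfolding a_def by (rule eventually_supercritical) (use assms c in \<open>auto simp: b_def\<close>)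
  ultimately show "eventually (\<lambda>k. norm (critical_value d k p
            - ((1 - p * real d) * (1 / real d ^ k)
               + (1 - p * real d)\<^sup>2 * p\<^sup>2 * real d / (1 - p\<^sup>2 * real d) * (1 / real d ^ (2 * k))))
         \<le> c * norm (1 / real d ^ (2 * k))) at_top"
  proof eventually_elim
    case (elim k)
    have dk: "0 < real d ^ k" using assms by simp
    define S where "S = {q \<in> {0..1}. measure (percolation d k p q)
            {\<omega> \<in> space (percolation d k p q). infinite (root_cluster d k \<omega>)} > 0}"
    have eq: "(a + t / real d ^ k) / real d ^ k = a * (1 / real d ^ k) + t * (1 / real d ^ (2 * k))" for t
    proof -
      have "real d ^ (2 * k) = real d ^ k * real d ^ k" by (simp add: mult_2 power_add)
      then show ?thesis by (simp add: add_divide_distrib)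
    qed
    have up: "(a + (b + c) / real d ^ k) / real d ^ k \<in> S" using elim(2) by (simp add: S_def)
    have "Inf S \<le> (a + (b + c) / real d ^ k) / real d ^ k"
      by (rule cInf_lower[OF up]) (auto simp: S_def bdd_below_def)
    moreover have "(a + (b - c) / real d ^ k) / real d ^ k \<le> Inf S"
    proof (rule cInf_greatest)
      show "S \<noteq> {}" using up by blast
      fix q assume "q \<in> S"
      then have "\<not> q * real d ^ k < a + (b - c) / real d ^ k" using elim(1) by (auto simp: S_def)
      then show "(a + (b - c) / real d ^ k) / real d ^ k \<le> q" using dk by (simp add: pos_divide_le_eq)
    qed
    moreover have "critical_value d k p = Inf S" by (simp add: critical_value_def S_def)
    ultimately have "\<bar>critical_value d k p - (a * (1 / real d ^ k) + b * (1 / real d ^ (2 * k)))\<bar>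
        \<le> c * (1 / real d ^ (2 * k))"
      unfolding eq by (simp only: distrib_right left_diff_distrib abs_le_iff) linarith
    then show ?case by (simp add: a_def b_def)
  qed
qed

end
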